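(* Let $k$ be a field, let $A$ be an involutive $k$-algebra, and let $M$ be an involutive $A$-bimodule. (1) The involutive center $iZ(M)=\mathrm{Hom}_{A\text{-}i\mathrm{Bimod}}(A,M)$ is naturally isomorphic to the pullback (i.e. intersection) of the involutive vector spaces $Z(M)\hookrightarrow M\hookleftarrow M^{\mathbb{Z}/2}$. (2) The involutive abelianization $iAb(M)=A\otimes_{A^{ie}}M$ is naturally isomorphic to the pushout of the involutive vector spaces $Ab(M)\leftarrow M\to M_{\mathbb{Z}/2}$.
   Context: An involutive vector space is a $k$-vector space $V$ with a linear map $v\mapsto v^*$ satisfying $v^{**}=v$, i.e. a $k$-linear representation of $\mathbb{Z}/2$; morphisms of involutive vector spaces are the linear maps commuting with the involutions. An involutive $k$-algebra is an associative unital $k$-algebra $A$ that is an involutive vector space with $(ab)^*=b^*a^*$. An involutive $A$-bimodule is an $A$-bimodule $M$ that is an involutive vector space with $(a\cdot m)^*=m^*\cdot a^*$. $A$ itself is an involutive $A$-bimodule. For involutive $A$-bimodules $M,N$, $\mathrm{Hom}_{A\text{-}i\mathrm{Bimod}}(M,N)$ is the $k$-vector space of bimodule homomorphisms commuting with the involutions; it is regarded as an involutive vector space with involution $f\mapsto f^*$, $f^*(m)=f(m)^*$, or equivalently $f(m^* )$. The center is $Z(M)=\{m\in M: am=ma \text{ for all } a\in A\}$, and the abelianization $Ab(M)$ is the quotient vector space of $M$ by the relations $am\sim ma$ for $a\in A$, $m\in M$. $M^{\mathbb{Z}/2}=\{m\in M: m^*=m\}$ is the space of invariants and $M_{\mathbb{Z}/2}$,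 the quotient of $M$ by the span of the elements $m-m^*$, is the space of coinvariants. These are regarded as involutive vector spaces with the involutions coming from $M$; the maps in the two diagrams are the inclusions and the quotient maps. Let $A^e=A\otimes_k A^{op}$. The involutive enveloping algebra $A^{ie}$ is $A^e\otimes_k k[\mathbb{Z}/2]$ with product $(x\otimes\tau^i)(y\otimes\tau^j)=(x\cdot\tau^i(y))\otimes\tau^{i+j}$, where $\tau$ is the generator of $\mathbb{Z}/2$, acting on $A^e$ by $\tau(a\otimes b)=b^*\otimes a^*$. Involutive $A$-bimodules are equivalent to $A^{ie}$-modules, with $A^e$ acting through the bimodule structure and $\tau$ acting by the involution. For involutive bimodules $M,N$, the vector space $M\otimes_{A^{ie}}N$ is the quotient of $M\otimes_{A^e}N$ (that is, of $M\otimes_k N$ modulo $am\otimes n=m\otimes na$ and $ma\otimes n=m\otimes an$) by the span of the elements $m^*\otimes n-m\otimes n^*$; it is regarded as an involutive vector space with involution $(m\otimes n)^*=m^*\otimes n=m\otimes n^*$.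
   Formalization: The involutions f*(m)=f(m)* on Hom and (m⊗n)*=m*⊗n on the tensor product are ill-defined in general (A=M=C over R); they are replaced by f*(m)=f(m* )* and (m⊗n)*=m*⊗n*, and compatibility with the original ones is also proved wherever those exist. *)

theory Defs
  imports "HOL-Algebra.Module" "HOL-Algebra.AbelCoset"
begin

section \<open>Involutive vector spaces, algebras and bimodules\<close>

text \<open>
  As in the record of modules, the inherited ring fields \<open>mult\<close> and \<open>one\<close> are meaningful only for
  algebras; for bare vector spaces they are ignored.
\<close>

record ('k, 'v) ivs = "('k, 'v) module" +
  star :: "'v \<Rightarrow> 'v"

record ('k, 'a, 'm) ibimod = "('k, 'm) ivs" +
  lact :: "'a \<Rightarrow> 'm \<Rightarrow> 'm"
  ract :: "'m \<Rightarrow> 'a \<Rightarrow> 'm"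

locale involutive_space = module K V
  for K :: "('k, 'e) ring_scheme" and V :: "('k, 'v, 'f) ivs_scheme" +
  assumes star_closed: "v \<in> carrier V \<Longrightarrow> star V v \<in> carrier V"
    and star_add: "\<lbrakk>v \<in> carrier V; w \<in> carrier V\<rbrakk> \<Longrightarrow>
      star V (v \<oplus>\<^bsub>V\<^esub> w) = star V v \<oplus>\<^bsub>V\<^esub> star V w"
    and star_smult: "\<lbrakk>c \<in> carrier K; v \<in> carrier V\<rbrakk> \<Longrightarrow>
      star V (c \<odot>\<^bsub>V\<^esub> v) = c \<odot>\<^bsub>V\<^esub> star V v"
    and star_star: "v \<in> carrier V \<Longrightarrow> star V (star V v) = v"

locale involutive_algebra = involutive_space K A + ring A
  for K :: "('k, 'e) ring_scheme" and A :: "('k, 'a, 'f) ivs_scheme" +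
  assumes smult_mult_left: "\<lbrakk>c \<in> carrier K; a \<in> carrier A; b \<in> carrier A\<rbrakk> \<Longrightarrow>
      c \<odot>\<^bsub>A\<^esub> (a \<otimes>\<^bsub>A\<^esub> b) = (c \<odot>\<^bsub>A\<^esub> a) \<otimes>\<^bsub>A\<^esub> b"
    and smult_mult_right: "\<lbrakk>c \<in> carrier K; a \<in> carrier A; b \<in> carrier A\<rbrakk> \<Longrightarrow>
      c \<odot>\<^bsub>A\<^esub> (a \<otimes>\<^bsub>A\<^esub> b) = a \<otimes>\<^bsub>A\<^esub> (c \<odot>\<^bsub>A\<^esub> b)"
    and star_mult: "\<lbrakk>a \<in> carrier A; b \<in> carrier A\<rbrakk> \<Longrightarrow>
      star A (a \<otimes>\<^bsub>A\<^esub> b) = star A b \<otimes>\<^bsub>A\<^esub> star A a"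

locale involutive_bimodule = A: involutive_algebra K A + involutive_space K M
  for K :: "('k, 'e) ring_scheme" and A :: "('k, 'a, 'f) ivs_scheme"
    and M :: "('k, 'a, 'm, 'g) ibimod_scheme" +
  assumes lact_closed: "\<lbrakk>a \<in> carrier A; m \<in> carrier M\<rbrakk> \<Longrightarrow> lact M a m \<in> carrier M"
    and ract_closed: "\<lbrakk>a \<in> carrier A; m \<in> carrier M\<rbrakk> \<Longrightarrow> ract M m a \<in> carrier M"
    and lact_add: "\<lbrakk>a \<in> carrier A; m \<in> carrier M; n \<in> carrier M\<rbrakk> \<Longrightarrow>
      lact M a (m \<oplus>\<^bsub>M\<^esub> n) = lact M a m \<oplus>\<^bsub>M\<^esub> lact M a n"
    and add_lact: "\<lbrakk>a \<in> carrier A; b \<in> carrier A; m \<in> carrier M\<rbrakk> \<Longrightarrow>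
      lact M (a \<oplus>\<^bsub>A\<^esub> b) m = lact M a m \<oplus>\<^bsub>M\<^esub> lact M b m"
    and add_ract: "\<lbrakk>a \<in> carrier A; m \<in> carrier M; n \<in> carrier M\<rbrakk> \<Longrightarrow>
      ract M (m \<oplus>\<^bsub>M\<^esub> n) a = ract M m a \<oplus>\<^bsub>M\<^esub> ract M n a"
    and ract_add: "\<lbrakk>a \<in> carrier A; b \<in> carrier A; m \<in> carrier M\<rbrakk> \<Longrightarrow>
      ract M m (a \<oplus>\<^bsub>A\<^esub> b) = ract M m a \<oplus>\<^bsub>M\<^esub> ract M m b"
    and smult_lact: "\<lbrakk>c \<in> carrier K; a \<in> carrier A; m \<in> carrier M\<rbrakk> \<Longrightarrow>
      lact M (c \<odot>\<^bsub>A\<^esub> a) m = c \<odot>\<^bsub>M\<^esub> lact M a m"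
    and lact_smult: "\<lbrakk>c \<in> carrier K; a \<in> carrier A; m \<in> carrier M\<rbrakk> \<Longrightarrow>
      lact M a (c \<odot>\<^bsub>M\<^esub> m) = c \<odot>\<^bsub>M\<^esub> lact M a m"
    and ract_smult: "\<lbrakk>c \<in> carrier K; a \<in> carrier A; m \<in> carrier M\<rbrakk> \<Longrightarrow>
      ract M m (c \<odot>\<^bsub>A\<^esub> a) = c \<odot>\<^bsub>M\<^esub> ract M m a"
    and smult_ract: "\<lbrakk>c \<in> carrier K; a \<in> carrier A; m \<in> carrier M\<rbrakk> \<Longrightarrow>
      ract M (c \<odot>\<^bsub>M\<^esub> m) a = c \<odot>\<^bsub>M\<^esub> ract M m a"
    and lact_one: "m \<in> carrier M \<Longrightarrow> lact M \<one>\<^bsub>A\<^esub> m = m"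
    and ract_one: "m \<in> carrier M \<Longrightarrow> ract M m \<one>\<^bsub>A\<^esub> = m"
    and lact_mult: "\<lbrakk>a \<in> carrier A; b \<in> carrier A; m \<in> carrier M\<rbrakk> \<Longrightarrow>
      lact M (a \<otimes>\<^bsub>A\<^esub> b) m = lact M a (lact M b m)"
    and ract_mult: "\<lbrakk>a \<in> carrier A; b \<in> carrier A; m \<in> carrier M\<rbrakk> \<Longrightarrow>
      ract M m (a \<otimes>\<^bsub>A\<^esub> b) = ract M (ract M m a) b"
    and lact_ract: "\<lbrakk>a \<in> carrier A; b \<in> carrier A; m \<in> carrier M\<rbrakk> \<Longrightarrow>
      ract M (lact M a m) b = lact M a (ract M m b)"
    and star_lact: "\<lbrakk>a \<in> carrier A; m \<in> carrier M\<rbrakk> \<Longrightarrow>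
      star M (lact M a m) = ract M (star M m) (star A a)"

definition regular :: "('k, 'a, 'f) ivs_scheme \<Rightarrow> ('k, 'a, 'a) ibimod" where
  "regular A = \<lparr>carrier = carrier A, mult = mult A, one = one A, zero = zero A, add = add A,
     smult = smult A, star = star A, lact = mult A, ract = mult A\<rparr>"

definition ivs_hom ::
  "('k, 'e) ring_scheme \<Rightarrow> ('k, 'v, 'f) ivs_scheme \<Rightarrow> ('k, 'w, 'g) ivs_scheme \<Rightarrow> ('v \<Rightarrow> 'w) set"
where
  "ivs_hom K V W = {h \<in> carrier V \<rightarrow> carrier W.
     (\<forall>v\<in>carrier V. \<forall>w\<in>carrier V. h (v \<oplus>\<^bsub>V\<^esub> w) = h v \<oplus>\<^bsub>W\<^esub> h w) \<and>
     (\<forall>c\<in>carrier K. \<forall>v\<in>carrier V. h (c \<odot>\<^bsub>V\<^esub> v) = c \<odot>\<^bsub>W\<^esub> h v) \<and>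
     (\<forall>v\<in>carrier V. h (star V v) = star W (h v))}"

definition ivs_iso ::
  "('k, 'e) ring_scheme \<Rightarrow> ('k, 'v, 'f) ivs_scheme \<Rightarrow> ('k, 'w, 'g) ivs_scheme \<Rightarrow> ('v \<Rightarrow> 'w) \<Rightarrow> bool"
where
  "ivs_iso K V W h \<longleftrightarrow> involutive_space K V \<and> involutive_space K W \<and>
     h \<in> ivs_hom K V W \<and> bij_betw h (carrier V) (carrier W)"

definition ibimod_hom ::
  "('k, 'e) ring_scheme \<Rightarrow> ('k, 'a, 'f) ivs_scheme \<Rightarrow> ('k, 'a, 'm, 'g) ibimod_scheme \<Rightarrow>
   ('k, 'a, 'n, 'h) ibimod_scheme \<Rightarrow> ('m \<Rightarrow> 'n) set"
where
  "ibimod_hom K A M N = {h \<in> ivs_hom K M N. \<forall>a\<in>carrier A. \<forall>m\<in>carrier M.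
     h (lact M a m) = lact N a (h m) \<and> h (ract M m a) = ract N (h m) a}"


section \<open>Quotients, sums, pullbacks and pushouts\<close>

definition lin_span :: "('k, 'e) ring_scheme \<Rightarrow> ('k, 'v, 'f) ivs_scheme \<Rightarrow> 'v set \<Rightarrow> 'v set" where
  "lin_span K V R = \<Inter>{H. submodule H K V \<and> R \<subseteq> H}"

definition qcls :: "('k, 'e) ring_scheme \<Rightarrow> ('k, 'v, 'f) ivs_scheme \<Rightarrow> 'v set \<Rightarrow> 'v \<Rightarrow> 'v set" where
  "qcls K V R v = lin_span K V R +>\<^bsub>V\<^esub> v"

text \<open>The map induced on cosets by a map \<open>h\<close> that is constant on each of them.\<close>

definition quot_lift :: "('v \<Rightarrow> 'w) \<Rightarrow> 'v set \<Rightarrow> 'w" where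
  "quot_lift h X = the_elem (h ` X)"

definition qspace ::
  "('k, 'e) ring_scheme \<Rightarrow> ('k, 'v, 'f) ivs_scheme \<Rightarrow> 'v set \<Rightarrow> ('k, 'v set) ivs"
where
  "qspace K V R = \<lparr>carrier = a_rcosets\<^bsub>V\<^esub> (lin_span K V R), mult = undefined, one = undefined,
     zero = lin_span K V R, add = set_add V,
     smult = (\<lambda>c. quot_lift (\<lambda>v. qcls K V R (c \<odot>\<^bsub>V\<^esub> v))),
     star = quot_lift (\<lambda>v. qcls K V R (star V v))\<rparr>"

definition quot_map ::
  "('k, 'e) ring_scheme \<Rightarrow> ('k, 'w, 'f) ivs_scheme \<Rightarrow> 'w set \<Rightarrow> ('v \<Rightarrow> 'w) \<Rightarrow> 'v set \<Rightarrow> 'w set"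
where
  "quot_map K W S h = quot_lift (\<lambda>v. qcls K W S (h v))"

definition dsum ::
  "('k, 'v, 'f) ivs_scheme \<Rightarrow> ('k, 'w, 'g) ivs_scheme \<Rightarrow> ('k, 'v \<times> 'w) ivs"
where
  "dsum V W = \<lparr>carrier = carrier V \<times> carrier W, mult = undefined, one = undefined,
     zero = (\<zero>\<^bsub>V\<^esub>, \<zero>\<^bsub>W\<^esub>),
     add = (\<lambda>(v, w) (v', w'). (v \<oplus>\<^bsub>V\<^esub> v', w \<oplus>\<^bsub>W\<^esub> w')),
     smult = (\<lambda>c (v, w). (c \<odot>\<^bsub>V\<^esub> v, c \<odot>\<^bsub>W\<^esub> w)),
     star = map_prod (star V) (star W)\<rparr>"

text \<open>The pullback of \<open>f : V \<rightarrow> U \<leftarrow> W : g\<close>.\<close>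

definition pullback ::
  "('k, 'v, 'f) ivs_scheme \<Rightarrow> ('k, 'w, 'g) ivs_scheme \<Rightarrow> ('v \<Rightarrow> 'u) \<Rightarrow> ('w \<Rightarrow> 'u) \<Rightarrow>
   ('k, 'v \<times> 'w) ivs"
where
  "pullback V W f g =
     (dsum V W)\<lparr>carrier := {(v, w) \<in> carrier V \<times> carrier W. f v = g w}\<rparr>"

text \<open>The pushout of \<open>f : V \<leftarrow> U \<rightarrow> W : g\<close>, with its map from \<open>V\<close>.\<close>

definition pushout_rel ::
  "('k, 'u, 'e) ivs_scheme \<Rightarrow> ('k, 'w, 'g) ivs_scheme \<Rightarrow> ('u \<Rightarrow> 'v) \<Rightarrow> ('u \<Rightarrow> 'w) \<Rightarrow> ('v \<times> 'w) set"
where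
  "pushout_rel U W f g = {(f u, \<ominus>\<^bsub>W\<^esub> g u) | u. u \<in> carrier U}"

definition pushout ::
  "('k, 'e) ring_scheme \<Rightarrow> ('k, 'v, 'f) ivs_scheme \<Rightarrow> ('k, 'u, 'h) ivs_scheme \<Rightarrow>
   ('k, 'w, 'g) ivs_scheme \<Rightarrow> ('u \<Rightarrow> 'v) \<Rightarrow> ('u \<Rightarrow> 'w) \<Rightarrow> ('k, ('v \<times> 'w) set) ivs"
where
  "pushout K V U W f g = qspace K (dsum V W) (pushout_rel U W f g)"

definition pushout_inl ::
  "('k, 'e) ring_scheme \<Rightarrow> ('k, 'v, 'f) ivs_scheme \<Rightarrow> ('k, 'u, 'h) ivs_scheme \<Rightarrow>
   ('k, 'w, 'g) ivs_scheme \<Rightarrow> ('u \<Rightarrow> 'v) \<Rightarrow> ('u \<Rightarrow> 'w) \<Rightarrow> 'v \<Rightarrow> ('v \<times> 'w) set"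
where
  "pushout_inl K V U W f g v = qcls K (dsum V W) (pushout_rel U W f g) (v, \<zero>\<^bsub>W\<^esub>)"


section \<open>Free vector spaces and tensor products\<close>

text \<open>
  The free vector space on a set \<open>X\<close>, as the finitely supported functions on \<open>X\<close>; its involution
  is induced by an involution \<open>i\<close> of \<open>X\<close>.
\<close>

definition free_space :: "('k, 'e) ring_scheme \<Rightarrow> 'x set \<Rightarrow> ('x \<Rightarrow> 'x) \<Rightarrow> ('k, 'x \<Rightarrow> 'k) ivs" where
  "free_space K X i = \<lparr>carrier = {f \<in> X \<rightarrow>\<^sub>E carrier K. finite {x \<in> X. f x \<noteq> \<zero>\<^bsub>K\<^esub>}},
     mult = undefined, one = undefined,
     zero = (\<lambda>x\<in>X. \<zero>\<^bsub>K\<^esub>),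
     add = (\<lambda>f g. \<lambda>x\<in>X. f x \<oplus>\<^bsub>K\<^esub> g x),
     smult = (\<lambda>c f. \<lambda>x\<in>X. c \<otimes>\<^bsub>K\<^esub> f x),
     star = (\<lambda>f. \<lambda>x\<in>X. f (i x))\<rparr>"

definition basis :: "('k, 'e) ring_scheme \<Rightarrow> 'x set \<Rightarrow> 'x \<Rightarrow> 'x \<Rightarrow> 'k" where
  "basis K X x = (\<lambda>y\<in>X. if y = x then \<one>\<^bsub>K\<^esub> else \<zero>\<^bsub>K\<^esub>)"

text \<open>The linear extension to the free vector space on \<open>X\<close> of a map \<open>g\<close> from \<open>X\<close> to \<open>W\<close>.\<close>

definition free_lift ::
  "('k, 'e) ring_scheme \<Rightarrow> 'x set \<Rightarrow> ('k, 'w, 'f) ivs_scheme \<Rightarrow> ('x \<Rightarrow> 'w) \<Rightarrow> ('x \<Rightarrow> 'k) \<Rightarrow> 'w"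
where
  "free_lift K X W g f = (\<Oplus>\<^bsub>W\<^esub>x\<in>{x \<in> X. f x \<noteq> \<zero>\<^bsub>K\<^esub>}. f x \<odot>\<^bsub>W\<^esub> g x)"

definition free_pairs ::
  "('k, 'e) ring_scheme \<Rightarrow> ('k, 'v, 'f) ivs_scheme \<Rightarrow> ('k, 'w, 'g) ivs_scheme \<Rightarrow>
   ('k, 'v \<times> 'w \<Rightarrow> 'k) ivs"
where
  "free_pairs K V W = free_space K (carrier V \<times> carrier W) (map_prod (star V) (star W))"

definition bilin_rel ::
  "('k, 'e) ring_scheme \<Rightarrow> ('k, 'v, 'f) ivs_scheme \<Rightarrow> ('k, 'w, 'g) ivs_scheme \<Rightarrow>
   ('v \<times> 'w \<Rightarrow> 'k) set"
where
  "bilin_rel K V W =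
    (let F = free_pairs K V W; b = (\<lambda>v w. basis K (carrier V \<times> carrier W) (v, w)) in
      {b (v \<oplus>\<^bsub>V\<^esub> v') w \<ominus>\<^bsub>F\<^esub> (b v w \<oplus>\<^bsub>F\<^esub> b v' w) | v v' w.
         v \<in> carrier V \<and> v' \<in> carrier V \<and> w \<in> carrier W} \<union>
      {b v (w \<oplus>\<^bsub>W\<^esub> w') \<ominus>\<^bsub>F\<^esub> (b v w \<oplus>\<^bsub>F\<^esub> b v w') | v w w'.
         v \<in> carrier V \<and> w \<in> carrier W \<and> w' \<in> carrier W} \<union>
      {b (c \<odot>\<^bsub>V\<^esub> v) w \<ominus>\<^bsub>F\<^esub> c \<odot>\<^bsub>F\<^esub> b v w | c v w.
         c \<in> carrier K \<and> v \<in> carrier V \<and> w \<in> carrier W} \<union>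
      {b v (c \<odot>\<^bsub>W\<^esub> w) \<ominus>\<^bsub>F\<^esub> c \<odot>\<^bsub>F\<^esub> b v w | c v w.
         c \<in> carrier K \<and> v \<in> carrier V \<and> w \<in> carrier W})"

text \<open>
  The involution here is \<open>(v \<otimes> w)\<^sup>* = v\<^sup>* \<otimes> w\<^sup>*\<close>. It descends to the quotients over \<open>A\<^sup>e\<close> and over
  \<open>A\<^sup>i\<^sup>e\<close> below, whereas \<open>m \<otimes> n \<mapsto> m\<^sup>* \<otimes> n\<close> in general descends to neither: for \<open>M = N = A\<close> the complex
  numbers over the reals with conjugation, it would send the equal elements \<open>\<i> \<otimes> \<i>\<close> and
  \<open>1 \<otimes> -1\<close> over \<open>A\<^sup>i\<^sup>e\<close> to \<open>-(\<i> \<otimes> \<i>)\<close> and \<open>1 \<otimes> -1\<close>, and this element is nonzero.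
\<close>

definition tensor_k ::
  "('k, 'e) ring_scheme \<Rightarrow> ('k, 'v, 'f) ivs_scheme \<Rightarrow> ('k, 'w, 'g) ivs_scheme \<Rightarrow>
   ('k, ('v \<times> 'w \<Rightarrow> 'k) set) ivs"
where
  "tensor_k K V W = qspace K (free_pairs K V W) (bilin_rel K V W)"

definition pure_k ::
  "('k, 'e) ring_scheme \<Rightarrow> ('k, 'v, 'f) ivs_scheme \<Rightarrow> ('k, 'w, 'g) ivs_scheme \<Rightarrow>
   'v \<Rightarrow> 'w \<Rightarrow> ('v \<times> 'w \<Rightarrow> 'k) set"
where
  "pure_k K V W v w =
     qcls K (free_pairs K V W) (bilin_rel K V W) (basis K (carrier V \<times> carrier W) (v, w))"

definition balance_rel ::
  "('k, 'e) ring_scheme \<Rightarrow> ('k, 'a, 'f) ivs_scheme \<Rightarrow> ('k, 'a, 'm, 'g) ibimod_scheme \<Rightarrow>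
   ('k, 'a, 'n, 'h) ibimod_scheme \<Rightarrow> ('m \<times> 'n \<Rightarrow> 'k) set set"
where
  "balance_rel K A M N =
    (let T = tensor_k K M N; t = pure_k K M N in
      {t (lact M a m) n \<ominus>\<^bsub>T\<^esub> t m (ract N n a) | a m n.
         a \<in> carrier A \<and> m \<in> carrier M \<and> n \<in> carrier N} \<union>
      {t (ract M m a) n \<ominus>\<^bsub>T\<^esub> t m (lact N a n) | a m n.
         a \<in> carrier A \<and> m \<in> carrier M \<and> n \<in> carrier N})"

definition tensor_env ::
  "('k, 'e) ring_scheme \<Rightarrow> ('k, 'a, 'f) ivs_scheme \<Rightarrow> ('k, 'a, 'm, 'g) ibimod_scheme \<Rightarrow>
   ('k, 'a, 'n, 'h) ibimod_scheme \<Rightarrow> ('k, ('m \<times> 'n \<Rightarrow> 'k) set set) ivs"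
where
  "tensor_env K A M N = qspace K (tensor_k K M N) (balance_rel K A M N)"

definition pure_env ::
  "('k, 'e) ring_scheme \<Rightarrow> ('k, 'a, 'f) ivs_scheme \<Rightarrow> ('k, 'a, 'm, 'g) ibimod_scheme \<Rightarrow>
   ('k, 'a, 'n, 'h) ibimod_scheme \<Rightarrow> 'm \<Rightarrow> 'n \<Rightarrow> ('m \<times> 'n \<Rightarrow> 'k) set set"
where
  "pure_env K A M N m n = qcls K (tensor_k K M N) (balance_rel K A M N) (pure_k K M N m n)"

definition star_rel ::
  "('k, 'e) ring_scheme \<Rightarrow> ('k, 'a, 'f) ivs_scheme \<Rightarrow> ('k, 'a, 'm, 'g) ibimod_scheme \<Rightarrow>
   ('k, 'a, 'n, 'h) ibimod_scheme \<Rightarrow> ('m \<times> 'n \<Rightarrow> 'k) set set set"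
where
  "star_rel K A M N =
    {pure_env K A M N (star M m) n \<ominus>\<^bsub>tensor_env K A M N\<^esub> pure_env K A M N m (star N n) | m n.
       m \<in> carrier M \<and> n \<in> carrier N}"

definition tensor_ienv ::
  "('k, 'e) ring_scheme \<Rightarrow> ('k, 'a, 'f) ivs_scheme \<Rightarrow> ('k, 'a, 'm, 'g) ibimod_scheme \<Rightarrow>
   ('k, 'a, 'n, 'h) ibimod_scheme \<Rightarrow> ('k, ('m \<times> 'n \<Rightarrow> 'k) set set set) ivs"
where
  "tensor_ienv K A M N = qspace K (tensor_env K A M N) (star_rel K A M N)"

definition pure_ienv ::
  "('k, 'e) ring_scheme \<Rightarrow> ('k, 'a, 'f) ivs_scheme \<Rightarrow> ('k, 'a, 'm, 'g) ibimod_scheme \<Rightarrow>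
   ('k, 'a, 'n, 'h) ibimod_scheme \<Rightarrow> 'm \<Rightarrow> 'n \<Rightarrow> ('m \<times> 'n \<Rightarrow> 'k) set set set"
where
  "pure_ienv K A M N m n = qcls K (tensor_env K A M N) (star_rel K A M N) (pure_env K A M N m n)"

text \<open>
  The linear map out of \<open>M \<otimes> N\<close> (over \<open>A\<^sup>i\<^sup>e\<close>) induced by a bilinear map \<open>g\<close> into \<open>W\<close> that respects
  the defining relations.
\<close>

definition ienv_lift ::
  "('k, 'e) ring_scheme \<Rightarrow> ('k, 'a, 'm, 'g) ibimod_scheme \<Rightarrow> ('k, 'a, 'n, 'h) ibimod_scheme \<Rightarrow>
   ('k, 'w, 'f) ivs_scheme \<Rightarrow> ('m \<Rightarrow> 'n \<Rightarrow> 'w) \<Rightarrow> ('m \<times> 'n \<Rightarrow> 'k) set set set \<Rightarrow> 'w"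
where
  "ienv_lift K M N W g =
     quot_lift (quot_lift (quot_lift (free_lift K (carrier M \<times> carrier N) W (\<lambda>(m, n). g m n))))"


section \<open>Involutive center and abelianization\<close>

text \<open>
  For involutive bimodules, \<open>f\<^sup>*(m) = f(m\<^sup>*)\<^sup>*\<close> is again a homomorphism of involutive bimodules,
  whereas the pointwise \<open>f(m)\<^sup>*\<close> in general is not: for \<open>A\<close> the complex numbers over the reals with
  conjugation, the pointwise star of the identity of \<open>A\<close> is not \<open>A\<close>-linear. So the former is the
  involution of the space of homomorphisms, and the latter is kept separately as \<open>pointwise_star\<close>.
\<close>

definition ibimod_Hom ::
  "('k, 'e) ring_scheme \<Rightarrow> ('k, 'a, 'f) ivs_scheme \<Rightarrow> ('k, 'a, 'm, 'g) ibimod_scheme \<Rightarrow>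
   ('k, 'a, 'n, 'h) ibimod_scheme \<Rightarrow> ('k, 'm \<Rightarrow> 'n) ivs"
where
  "ibimod_Hom K A M N = \<lparr>carrier = ibimod_hom K A M N \<inter> extensional (carrier M),
     mult = undefined, one = undefined,
     zero = (\<lambda>m\<in>carrier M. \<zero>\<^bsub>N\<^esub>),
     add = (\<lambda>f g. \<lambda>m\<in>carrier M. f m \<oplus>\<^bsub>N\<^esub> g m),
     smult = (\<lambda>c f. \<lambda>m\<in>carrier M. c \<odot>\<^bsub>N\<^esub> f m),
     star = (\<lambda>f. \<lambda>m\<in>carrier M. star N (f (star M m)))\<rparr>"

definition pointwise_star ::
  "('k, 'm, 'g) ivs_scheme \<Rightarrow> ('k, 'n, 'h) ivs_scheme \<Rightarrow> ('m \<Rightarrow> 'n) \<Rightarrow> 'm \<Rightarrow> 'n"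
where
  "pointwise_star M N f = (\<lambda>m\<in>carrier M. star N (f m))"

definition iZ ::
  "('k, 'e) ring_scheme \<Rightarrow> ('k, 'a, 'f) ivs_scheme \<Rightarrow> ('k, 'a, 'm, 'g) ibimod_scheme \<Rightarrow>
   ('k, 'a \<Rightarrow> 'm) ivs"
where
  "iZ K A M = ibimod_Hom K A (regular A) M"

definition iAb ::
  "('k, 'e) ring_scheme \<Rightarrow> ('k, 'a, 'f) ivs_scheme \<Rightarrow> ('k, 'a, 'm, 'g) ibimod_scheme \<Rightarrow>
   ('k, ('a \<times> 'm \<Rightarrow> 'k) set set set) ivs"
where
  "iAb K A M = tensor_ienv K A (regular A) M"

definition centre :: "('k, 'a, 'f) ivs_scheme \<Rightarrow> ('k, 'a, 'm, 'g) ibimod_scheme \<Rightarrow> 'm set" where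
  "centre A M = {m \<in> carrier M. \<forall>a\<in>carrier A. lact M a m = ract M m a}"

definition invariants :: "('k, 'v, 'g) ivs_scheme \<Rightarrow> 'v set" where
  "invariants V = {v \<in> carrier V. star V v = v}"

definition Zc :: "('k, 'a, 'f) ivs_scheme \<Rightarrow> ('k, 'a, 'm, 'g) ibimod_scheme \<Rightarrow>
   ('k, 'a, 'm, 'g) ibimod_scheme" where
  "Zc A M = M\<lparr>carrier := centre A M\<rparr>"

definition Inv :: "('k, 'v, 'g) ivs_scheme \<Rightarrow> ('k, 'v, 'g) ivs_scheme" where
  "Inv V = V\<lparr>carrier := invariants V\<rparr>"

definition comm_rel :: "('k, 'a, 'f) ivs_scheme \<Rightarrow> ('k, 'a, 'm, 'g) ibimod_scheme \<Rightarrow> 'm set" where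
  "comm_rel A M = {lact M a m \<ominus>\<^bsub>M\<^esub> ract M m a | a m. a \<in> carrier A \<and> m \<in> carrier M}"

definition coinv_rel :: "('k, 'v, 'g) ivs_scheme \<Rightarrow> 'v set" where
  "coinv_rel V = {v \<ominus>\<^bsub>V\<^esub> star V v | v. v \<in> carrier V}"

definition Ab ::
  "('k, 'e) ring_scheme \<Rightarrow> ('k, 'a, 'f) ivs_scheme \<Rightarrow> ('k, 'a, 'm, 'g) ibimod_scheme \<Rightarrow>
   ('k, 'm set) ivs"
where
  "Ab K A M = qspace K M (comm_rel A M)"

definition Coinv :: "('k, 'e) ring_scheme \<Rightarrow> ('k, 'v, 'g) ivs_scheme \<Rightarrow> ('k, 'v set) ivs" where
  "Coinv K V = qspace K V (coinv_rel V)"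

definition iZ_pullback ::
  "('k, 'a, 'f) ivs_scheme \<Rightarrow> ('k, 'a, 'm, 'g) ibimod_scheme \<Rightarrow> ('k, 'm \<times> 'm) ivs"
where
  "iZ_pullback A M = pullback (Zc A M) (Inv M) (\<lambda>m. m) (\<lambda>m. m)"

definition iAb_pushout ::
  "('k, 'e) ring_scheme \<Rightarrow> ('k, 'a, 'f) ivs_scheme \<Rightarrow> ('k, 'a, 'm, 'g) ibimod_scheme \<Rightarrow>
   ('k, ('m set \<times> 'm set) set) ivs"
where
  "iAb_pushout K A M = pushout K (Ab K A M) M (Coinv K M)
     (qcls K M (comm_rel A M)) (qcls K M (coinv_rel M))"

definition iAb_inl ::
  "('k, 'e) ring_scheme \<Rightarrow> ('k, 'a, 'f) ivs_scheme \<Rightarrow> ('k, 'a, 'm, 'g) ibimod_scheme \<Rightarrow>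
   'm set \<Rightarrow> ('m set \<times> 'm set) set"
where
  "iAb_inl K A M = pushout_inl K (Ab K A M) M (Coinv K M)
     (qcls K M (comm_rel A M)) (qcls K M (coinv_rel M))"


section \<open>Comparison maps and functoriality\<close>

definition iZ_compare :: "('k, 'a, 'f) ivs_scheme \<Rightarrow> ('a \<Rightarrow> 'm) \<Rightarrow> 'm \<times> 'm" where
  "iZ_compare A f = (f \<one>\<^bsub>A\<^esub>, f \<one>\<^bsub>A\<^esub>)"

definition iAb_compare ::
  "('k, 'e) ring_scheme \<Rightarrow> ('k, 'a, 'f) ivs_scheme \<Rightarrow> ('k, 'a, 'm, 'g) ibimod_scheme \<Rightarrow>
   ('a \<times> 'm \<Rightarrow> 'k) set set set \<Rightarrow> ('m set \<times> 'm set) set"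
where
  "iAb_compare K A M = ienv_lift K (regular A) M (iAb_pushout K A M)
     (\<lambda>a m. iAb_inl K A M (qcls K M (comm_rel A M) (lact M a m)))"

definition iZ_map :: "('k, 'a, 'f) ivs_scheme \<Rightarrow> ('m \<Rightarrow> 'n) \<Rightarrow> ('a \<Rightarrow> 'm) \<Rightarrow> 'a \<Rightarrow> 'n" where
  "iZ_map A h f = (\<lambda>a\<in>carrier A. h (f a))"

definition iAb_map ::
  "('k, 'e) ring_scheme \<Rightarrow> ('k, 'a, 'f) ivs_scheme \<Rightarrow> ('k, 'a, 'm, 'g) ibimod_scheme \<Rightarrow>
   ('k, 'a, 'n, 'h) ibimod_scheme \<Rightarrow> ('m \<Rightarrow> 'n) \<Rightarrow>
   ('a \<times> 'm \<Rightarrow> 'k) set set set \<Rightarrow> ('a \<times> 'n \<Rightarrow> 'k) set set set"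
where
  "iAb_map K A M N h = ienv_lift K (regular A) M (iAb K A N)
     (\<lambda>a m. pure_ienv K A (regular A) N a (h m))"

definition iAb_pushout_map ::
  "('k, 'e) ring_scheme \<Rightarrow> ('k, 'a, 'f) ivs_scheme \<Rightarrow> ('k, 'a, 'n, 'g) ibimod_scheme \<Rightarrow>
   ('m \<Rightarrow> 'n) \<Rightarrow> ('m set \<times> 'm set) set \<Rightarrow> ('n set \<times> 'n set) set"
where
  "iAb_pushout_map K A N h =
     quot_map K (dsum (Ab K A N) (Coinv K N))
       (pushout_rel N (Coinv K N) (qcls K N (comm_rel A N)) (qcls K N (coinv_rel N)))
       (map_prod (quot_map K N (comm_rel A N) h) (quot_map K N (coinv_rel N) h))"

end

theory Submission
  imports Defs
begin

text \<open>
  A homomorphism of involutive bimodules out of \<open>A\<close> is determined by the image \<open>m\<close> of \<open>1\<close>, and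
  \<open>a \<mapsto> a m\<close> is such a homomorphism exactly when \<open>m\<close> is central and \<open>m\<^sup>* = m\<close>. Dually, write
  \<open>j m = 1 \<otimes> m\<close> in \<open>A \<otimes> M\<close> over \<open>A\<^sup>i\<^sup>e\<close>. Since \<open>a \<otimes> m = 1 \<otimes> a m\<close>, the map \<open>j\<close> is surjective, and it
  satisfies \<open>j (a m) = j (m a)\<close> and \<open>j (m\<^sup>*) = j m\<close>; so it factors through \<open>Ab M\<close> and through the
  coinvariants, and the induced map out of the pushout inverts the comparison map.
\<close>

section \<open>Images, subspaces and quotients\<close>

text \<open>The tensor product over A^ie is built as a threefold quotient of a free space. Its
  elements have no normal form, so injectivity of the comparison map cannot be read off from
  representatives and has to come from a map in the opposite direction. For this reason each
  quotient is used only through its universal property, and a claim about a span is proved by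
  exhibiting a submodule that contains the generators. All maps out of \<open>iAb\<close>, the
  comparison map and the functorial maps alike, come from one principle: a star-preserving linear
  map \<phi> on M with \<phi>(m a) = \<phi>(a m) and \<phi>(star m) = \<phi>(m) prescribes the
  values on the elements \<open>1 \<otimes> m\<close>. The involution is the other delicate point.
  Over A^ie, star(m) \<otimes> star(n) equals m \<otimes> n, so the involution there is the
  identity; every homomorphism in \<open>iZ\<close> is fixed as well. This is how the theorem can
  also treat the other involutions that are in use.\<close>

text \<open>The axioms are equations, up to the existence of negatives, so they pass to the image of
  a map that respects the operations. \<open>W\<close> is only a record here, not yet known to be a
  group, so preservation of zero has to be assumed. Quotients, \<open>iZ\<close>, the pullback and
  \<open>regular A\<close> all obtain their structure this way.\<close>

lemma involutive_space_image:
  assumes V: "involutive_space K V"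
    and img: "h ` carrier V = carrier W"
    and add: "\<And>v w. \<lbrakk>v \<in> carrier V; w \<in> carrier V\<rbrakk> \<Longrightarrow> h (v \<oplus>\<^bsub>V\<^esub> w) = h v \<oplus>\<^bsub>W\<^esub> h w"
    and zero: "h \<zero>\<^bsub>V\<^esub> = \<zero>\<^bsub>W\<^esub>"
    and smult: "\<And>c v. \<lbrakk>c \<in> carrier K; v \<in> carrier V\<rbrakk> \<Longrightarrow> h (c \<odot>\<^bsub>V\<^esub> v) = c \<odot>\<^bsub>W\<^esub> h v"
    and star: "\<And>v. v \<in> carrier V \<Longrightarrow> h (star V v) = star W (h v)"
  shows "involutive_space K W"
proof -
  interpret V: involutive_space K V by fact
  \<comment> \<open>Read backwards, the hypotheses turn an operation of \<open>W\<close> on values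
    of \<open>h\<close> into a value of \<open>h\<close>, so each axiom reduces to the one in
    \<open>V\<close>.\<close>
  note simps = add[symmetric] zero[symmetric] smult[symmetric] star[symmetric]
  have ex: "\<And>x. x \<in> carrier W \<Longrightarrow> \<exists>v\<in>carrier V. x = h v"
    using img by blast
  have hW: "\<And>v. v \<in> carrier V \<Longrightarrow> h v \<in> carrier W"
    using img by blast
  have "abelian_group W"
  proof (rule abelian_groupI)
    fix x y assume "x \<in> carrier W" "y \<in> carrier W"
    with ex obtain v w where "v \<in> carrier V" "w \<in> carrier V" "x = h v" "y = h w" by metis
    then show "x \<oplus>\<^bsub>W\<^esub> y \<in> carrier W" "x \<oplus>\<^bsub>W\<^esub> y = y \<oplus>\<^bsub>W\<^esub> x"
      by (simp_all add: simps hW V.M.a_comm)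
  next
    show "\<zero>\<^bsub>W\<^esub> \<in> carrier W" by (simp add: simps hW)
  next
    fix x y z assume "x \<in> carrier W" "y \<in> carrier W" "z \<in> carrier W"
    with ex obtain u v w where "u \<in> carrier V" "v \<in> carrier V" "w \<in> carrier V"
      "x = h u" "y = h v" "z = h w" by metis
    then show "x \<oplus>\<^bsub>W\<^esub> y \<oplus>\<^bsub>W\<^esub> z = x \<oplus>\<^bsub>W\<^esub> (y \<oplus>\<^bsub>W\<^esub> z)"
      by (simp add: simps V.M.a_assoc)
  next
    fix x assume "x \<in> carrier W"
    with ex obtain v where v: "v \<in> carrier V" "x = h v" by metis
    then show "\<zero>\<^bsub>W\<^esub> \<oplus>\<^bsub>W\<^esub> x = x" by (simp add: simps)
    have "h (\<ominus>\<^bsub>V\<^esub> v) \<oplus>\<^bsub>W\<^esub> x = \<zero>\<^bsub>W\<^esub>"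
      using v by (simp add: simps V.M.l_neg)
    then show "\<exists>y\<in>carrier W. y \<oplus>\<^bsub>W\<^esub> x = \<zero>\<^bsub>W\<^esub>"
      using hW v by blast
  qed
  moreover have "involutive_space_axioms K W"
  proof
    fix c v w assume "v \<in> carrier W" "w \<in> carrier W"
    with ex obtain v' w' where "v' \<in> carrier V" "w' \<in> carrier V" "v = h v'" "w = h w'" by metis
    then show "star W v \<in> carrier W" "star W (star W v) = v"
      "star W (v \<oplus>\<^bsub>W\<^esub> w) = star W v \<oplus>\<^bsub>W\<^esub> star W w"
      "c \<in> carrier K \<Longrightarrow> star W (c \<odot>\<^bsub>W\<^esub> v) = c \<odot>\<^bsub>W\<^esub> star W v"
      by (simp_all add: simps hW V.star_closed V.star_star V.star_add V.star_smult)
  qed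
  moreover have "module_axioms K W"
  proof
    fix a b x y assume "x \<in> carrier W" "y \<in> carrier W" and a: "a \<in> carrier K"
    with ex obtain v w where vw: "v \<in> carrier V" "w \<in> carrier V" "x = h v" "y = h w" by metis
    with a show "a \<odot>\<^bsub>W\<^esub> x \<in> carrier W"
      "a \<odot>\<^bsub>W\<^esub> (x \<oplus>\<^bsub>W\<^esub> y) = a \<odot>\<^bsub>W\<^esub> x \<oplus>\<^bsub>W\<^esub> a \<odot>\<^bsub>W\<^esub> y"
      by (simp_all add: simps hW V.smult_r_distr)
    assume "b \<in> carrier K"
    with a vw show "(a \<oplus>\<^bsub>K\<^esub> b) \<odot>\<^bsub>W\<^esub> x = a \<odot>\<^bsub>W\<^esub> x \<oplus>\<^bsub>W\<^esub> b \<odot>\<^bsub>W\<^esub> x"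
      "a \<otimes>\<^bsub>K\<^esub> b \<odot>\<^bsub>W\<^esub> x = a \<odot>\<^bsub>W\<^esub> (b \<odot>\<^bsub>W\<^esub> x)"
      by (simp_all add: simps V.smult_l_distr V.smult_assoc1)
  next
    fix x assume "x \<in> carrier W"
    with ex obtain v where "v \<in> carrier V" "x = h v" by metis
    then show "\<one>\<^bsub>K\<^esub> \<odot>\<^bsub>W\<^esub> x = x" by (simp add: simps)
  qed
  ultimately show ?thesis
    by (intro involutive_space.intro module.intro V.R.cring_axioms)
qed

lemma involutive_space_subspace:
  assumes V: "involutive_space K V" and H: "submodule H K V"
    and star: "\<And>v. v \<in> H \<Longrightarrow> star V v \<in> H"
  shows "involutive_space K (V\<lparr>carrier := H\<rparr>)"
proof -
  interpret V: involutive_space K V by fact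
  have sub: "H \<subseteq> carrier V" using V.submoduleE(1)[OF H] .
  show ?thesis
    using submodule.submodule_is_module[OF H V.module_axioms] star sub
    by (auto simp: involutive_space_def involutive_space_axioms_def subset_iff
      V.star_add V.star_smult V.star_star)
qed

lemma ivs_homI:
  assumes "\<And>v. v \<in> carrier V \<Longrightarrow> h v \<in> carrier W"
    and "\<And>v w. \<lbrakk>v \<in> carrier V; w \<in> carrier V\<rbrakk> \<Longrightarrow> h (v \<oplus>\<^bsub>V\<^esub> w) = h v \<oplus>\<^bsub>W\<^esub> h w"
    and "\<And>c v. \<lbrakk>c \<in> carrier K; v \<in> carrier V\<rbrakk> \<Longrightarrow> h (c \<odot>\<^bsub>V\<^esub> v) = c \<odot>\<^bsub>W\<^esub> h v"
    and "\<And>v. v \<in> carrier V \<Longrightarrow> h (star V v) = star W (h v)"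
  shows "h \<in> ivs_hom K V W"
  using assms by (auto simp: ivs_hom_def)

lemma ivs_homD:
  assumes "h \<in> ivs_hom K V W"
  shows "v \<in> carrier V \<Longrightarrow> h v \<in> carrier W"
    and "\<lbrakk>v \<in> carrier V; w \<in> carrier V\<rbrakk> \<Longrightarrow> h (v \<oplus>\<^bsub>V\<^esub> w) = h v \<oplus>\<^bsub>W\<^esub> h w"
    and "\<lbrakk>c \<in> carrier K; v \<in> carrier V\<rbrakk> \<Longrightarrow> h (c \<odot>\<^bsub>V\<^esub> v) = c \<odot>\<^bsub>W\<^esub> h v"
    and "v \<in> carrier V \<Longrightarrow> h (star V v) = star W (h v)"
  using assms by (auto simp: ivs_hom_def)

lemma ivs_hom_comp:
  "\<lbrakk>h \<in> ivs_hom K U V; g \<in> ivs_hom K V W\<rbrakk> \<Longrightarrow> (\<lambda>u. g (h u)) \<in> ivs_hom K U W"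
  by (auto simp: ivs_hom_def Pi_iff)

locale ivs_linear = V: involutive_space K V + W: involutive_space K W
  for K :: "('k, 'e) ring_scheme" and V :: "('k, 'v, 'f) ivs_scheme"
    and W :: "('k, 'w, 'g) ivs_scheme" +
  fixes h :: "'v \<Rightarrow> 'w"
  assumes hom: "h \<in> ivs_hom K V W"
begin

lemmas hom_closed [simp, intro] = ivs_homD(1)[OF hom]
  and hom_add = ivs_homD(2)[OF hom]
  and hom_smult = ivs_homD(3)[OF hom]
  and hom_star = ivs_homD(4)[OF hom]

sublocale gh: abelian_group_hom V W h
  by (rule abelian_group_homI[OF V.M.abelian_group_axioms W.M.abelian_group_axioms])
    (auto intro!: group_hom.intro group_hom_axioms.intro V.M.a_group W.M.a_group homI simp: hom_add)

lemma hom_minus: "\<lbrakk>v \<in> carrier V; w \<in> carrier V\<rbrakk> \<Longrightarrow> h (v \<ominus>\<^bsub>V\<^esub> w) = h v \<ominus>\<^bsub>W\<^esub> h w"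
  by (simp add: a_minus_def)

text \<open>Preimages of submodules, combined with \<open>lin_span_minimal\<close>, replace
  induction over linear combinations: a linear property holds on a whole span once the generators
  satisfy it.\<close>

lemma submodule_vimage:
  assumes H: "submodule H K W"
  shows "submodule {v \<in> carrier V. h v \<in> H} K V"
proof (rule V.submoduleI)
  have "\<zero>\<^bsub>W\<^esub> \<in> H"
    using H by (metis submodule_def subgroup.one_closed monoid.select_convs(2))
  then show "\<zero>\<^bsub>V\<^esub> \<in> {v \<in> carrier V. h v \<in> H}" by simp
qed (use W.submoduleE[OF H] in \<open>auto simp: hom_smult\<close>)

lemma submodule_kernel: "submodule {v \<in> carrier V. h v = \<zero>\<^bsub>W\<^esub>} K V"
  by (rule V.submoduleI) (auto simp: hom_smult)

end

context involutive_space
begin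

lemma submodule_lin_span:
  assumes "S \<subseteq> carrier V"
  shows "submodule (lin_span K V S) K V"
proof -
  \<comment> \<open>With the full carrier among the submodules intersected, the intersection is not
    the universal set.\<close>
  have c: "submodule (carrier V) K V" by (rule carrier_is_submodule)
  show ?thesis
  proof (rule submoduleI)
    show "lin_span K V S \<subseteq> carrier V"
      using assms c by (auto simp: lin_span_def)
    show "\<zero>\<^bsub>V\<^esub> \<in> lin_span K V S"
      by (auto simp: lin_span_def dest!: submodule.axioms(1) subgroup.one_closed)
  qed (auto simp: lin_span_def submoduleE)
qed

lemma lin_span_minimal: "\<lbrakk>submodule H K V; S \<subseteq> H\<rbrakk> \<Longrightarrow> lin_span K V S \<subseteq> H"
  by (auto simp: lin_span_def)

lemma lin_span_superset: "S \<subseteq> lin_span K V S"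
  by (auto simp: lin_span_def)

end

section \<open>Quotients by the span of a set of relations\<close>

lemma quot_lift_const:
  assumes "X \<noteq> {}" "\<And>x. x \<in> X \<Longrightarrow> h x = y"
  shows "quot_lift h X = y"
proof -
  have "h ` X = {y}" using assms by blast
  then show ?thesis by (simp add: quot_lift_def)
qed

text \<open>Only the span has to be stable under the involution: the star of a commutator a m - m a
  is minus another commutator, which lies in the span but need not be a relation itself.\<close>

locale ivs_quotient = involutive_space K V
  for K :: "('k, 'e) ring_scheme" and V :: "('k, 'v, 'f) ivs_scheme" +
  fixes R :: "'v set"
  assumes rel_closed: "R \<subseteq> carrier V"
    and rel_star: "\<And>r. r \<in> R \<Longrightarrow> star V r \<in> lin_span K V R"
begin

abbreviation "L \<equiv> lin_span K V R"
abbreviation "Q \<equiv> qspace K V R"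
abbreviation "cls \<equiv> qcls K V R"

lemma submodule_L: "submodule L K V"
  by (rule submodule_lin_span[OF rel_closed])

lemmas L_subset = submoduleE(1)[OF submodule_L]
  and L_smult = submoduleE(4)[OF submodule_L]

sublocale L: abelian_subgroup L V
  using submodule_L by (intro abelian_subgroupI3) (auto simp: submodule_def additive_subgroup_def M.abelian_group_axioms)

text \<open>The preimage of \<open>L\<close> under the involution is a submodule containing the
  relations.\<close>

lemma L_star: "l \<in> L \<Longrightarrow> star V l \<in> L"
proof -
  interpret s: ivs_linear K V V "star V"
    by unfold_locales (auto intro!: ivs_homI star_closed star_add star_smult)
  have "L \<subseteq> {v \<in> carrier V. star V v \<in> L}"
    using rel_closed rel_star by (intro lin_span_minimal s.submodule_vimage submodule_L) auto
  then show "l \<in> L \<Longrightarrow> star V l \<in> L" by blast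
qed

text \<open>No linearity of \<open>h\<close> is asked, only constancy on the coset. This lets the
  lemma evaluate the scalar multiplication and the involution of \<open>qspace\<close>, which are
  themselves lifts, before the quotient is known to be a space.\<close>

lemma quot_lift_cls:
  assumes "v \<in> carrier V" "\<And>l. l \<in> L \<Longrightarrow> h (l \<oplus>\<^bsub>V\<^esub> v) = h v"
  shows "quot_lift h (cls v) = h v"
proof (rule quot_lift_const)
  show "cls v \<noteq> {}"
    using L.a_rcos_self[OF assms(1)] by (auto simp: qcls_def)
qed (auto simp: qcls_def a_r_coset_def' assms(2))

lemma cls_eq_iff:
  assumes "v \<in> carrier V" "w \<in> carrier V"
  shows "cls v = cls w \<longleftrightarrow> v \<ominus>\<^bsub>V\<^esub> w \<in> L"
  unfolding qcls_def a_minus_def L.a_rcos_module[OF assms(2,1), symmetric]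
  using L.a_repr_independence'[OF _ assms(2)] L.a_repr_independenceD[OF assms(1)] by metis

lemma cls_absorb: "\<lbrakk>l \<in> L; v \<in> carrier V\<rbrakk> \<Longrightarrow> cls (l \<oplus>\<^bsub>V\<^esub> v) = cls v"
  using L_subset by (subst cls_eq_iff) (auto simp: a_minus_def M.a_assoc M.r_neg subset_iff)

lemma cls_add:
  "\<lbrakk>v \<in> carrier V; w \<in> carrier V\<rbrakk> \<Longrightarrow> cls (v \<oplus>\<^bsub>V\<^esub> w) = cls v \<oplus>\<^bsub>Q\<^esub> cls w"
  by (simp add: qspace_def qcls_def L.a_rcos_sum)

lemma cls_zero: "cls \<zero>\<^bsub>V\<^esub> = \<zero>\<^bsub>Q\<^esub>"
  by (simp add: qspace_def qcls_def L_subset)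

lemma cls_smult:
  "\<lbrakk>c \<in> carrier K; v \<in> carrier V\<rbrakk> \<Longrightarrow> cls (c \<odot>\<^bsub>V\<^esub> v) = c \<odot>\<^bsub>Q\<^esub> cls v"
  using L_subset by (simp add: qspace_def quot_lift_cls smult_r_distr cls_absorb L_smult subset_iff)

lemma cls_star: "v \<in> carrier V \<Longrightarrow> cls (star V v) = star Q (cls v)"
  using L_subset by (simp add: qspace_def quot_lift_cls star_add cls_absorb L_star star_closed subset_iff)

lemma cls_image: "cls ` carrier V = carrier Q"
  by (auto simp: qspace_def qcls_def A_RCOSETS_def')

sublocale Q: involutive_space K Q
  by (rule involutive_space_image[OF involutive_space_axioms cls_image cls_add cls_zero cls_smult cls_star])

sublocale cls: ivs_linear K V Q cls
  using cls_image by unfold_locales (auto intro!: ivs_homI cls_add cls_smult cls_star)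

lemma cls_eq_zero_iff: "v \<in> carrier V \<Longrightarrow> cls v = \<zero>\<^bsub>Q\<^esub> \<longleftrightarrow> v \<in> L"
proof -
  assume v: "v \<in> carrier V"
  have *: "v \<ominus>\<^bsub>V\<^esub> \<zero>\<^bsub>V\<^esub> = v"
    using v M.minus_equality[OF M.l_zero[OF M.zero_closed]] by (simp add: a_minus_def)
  show ?thesis using cls_eq_iff[OF v M.zero_closed] unfolding * cls_zero .
qed

lemma carrier_QE:
  assumes "X \<in> carrier Q"
  obtains v where "v \<in> carrier V" "X = cls v"
  using assms cls_image by blast

text \<open>Universal property of the quotient: the kernel of \<open>h\<close> is a submodule
  containing \<open>R\<close>, hence contains the span, so \<open>h\<close> is constant on
  cosets.\<close>

lemma
  assumes W: "involutive_space K W" and h: "h \<in> ivs_hom K V W"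
    and rel: "\<And>r. r \<in> R \<Longrightarrow> h r = \<zero>\<^bsub>W\<^esub>"
  shows quot_lift_hom: "quot_lift h \<in> ivs_hom K Q W"
    and quot_lift_eq: "v \<in> carrier V \<Longrightarrow> quot_lift h (cls v) = h v"
proof -
  interpret W: involutive_space K W by fact
  interpret h: ivs_linear K V W h using h by unfold_locales
  have "L \<subseteq> {v \<in> carrier V. h v = \<zero>\<^bsub>W\<^esub>}"
    using rel_closed rel by (intro lin_span_minimal h.submodule_kernel) auto
  then show eq: "\<And>v. v \<in> carrier V \<Longrightarrow> quot_lift h (cls v) = h v"
    by (intro quot_lift_cls) (auto simp: h.hom_add subset_iff)
  show "quot_lift h \<in> ivs_hom K Q W"
  proof (rule ivs_homI)
    fix c X Y assume "X \<in> carrier Q" "Y \<in> carrier Q"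
    then obtain v w where "v \<in> carrier V" "X = cls v" "w \<in> carrier V" "Y = cls w"
      by (metis carrier_QE)
    then show "quot_lift h X \<in> carrier W"
      "quot_lift h (X \<oplus>\<^bsub>Q\<^esub> Y) = quot_lift h X \<oplus>\<^bsub>W\<^esub> quot_lift h Y"
      "c \<in> carrier K \<Longrightarrow> quot_lift h (c \<odot>\<^bsub>Q\<^esub> X) = c \<odot>\<^bsub>W\<^esub> quot_lift h X"
      "quot_lift h (star Q X) = star W (quot_lift h X)"
      by (simp_all add: eq h.hom_add h.hom_smult h.hom_star star_closed 
          del: cls.gh.hom_add flip: cls_add cls_smult cls_star)
  qed
qed

text \<open>The elements of \<open>V\<close> whose class lies in the span of the images form a
  submodule containing \<open>S\<close>, hence all of \<open>V\<close>. This carries generators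
  through each stage of the iterated quotients.\<close>

lemma lin_span_cls:
  assumes S: "S \<subseteq> carrier V" and gen: "lin_span K V S = carrier V"
  shows "lin_span K Q (cls ` S) = carrier Q"
proof
  have img: "cls ` S \<subseteq> carrier Q" using S by auto
  show "lin_span K Q (cls ` S) \<subseteq> carrier Q"
    using Q.submoduleE(1)[OF Q.submodule_lin_span[OF img]] .
  have "lin_span K V S \<subseteq> {v \<in> carrier V. cls v \<in> lin_span K Q (cls ` S)}"
    using S Q.lin_span_superset[of "cls ` S"]
    by (intro lin_span_minimal cls.submodule_vimage[OF Q.submodule_lin_span[OF img]]) auto
  then show "carrier Q \<subseteq> lin_span K Q (cls ` S)"
    unfolding gen by (auto elim!: carrier_QE)
qed

lemma cls_eqI: "\<lbrakk>v \<ominus>\<^bsub>V\<^esub> w \<in> R; v \<in> carrier V; w \<in> carrier V\<rbrakk> \<Longrightarrow> cls v = cls w"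
  using lin_span_superset by (auto simp: cls_eq_iff)

end

section \<open>Free vector spaces\<close>

lemma (in ivs_linear) hom_finsum:
  "\<lbrakk>finite S; \<And>x. x \<in> S \<Longrightarrow> s x \<in> carrier V\<rbrakk> \<Longrightarrow> h (\<Oplus>\<^bsub>V\<^esub>x\<in>S. s x) = (\<Oplus>\<^bsub>W\<^esub>x\<in>S. h (s x))"
  by (induction S rule: finite_induct) (simp_all add: V.M.finsum_insert W.M.finsum_insert Pi_iff hom_add)

lemma (in involutive_space) ivs_linear_star: "ivs_linear K V V (star V)"
  by unfold_locales (auto intro!: ivs_homI star_closed star_add star_smult)

locale free_ivs = cring K for K :: "('k, 'e) ring_scheme" +
  fixes X :: "'x set" and i :: "'x \<Rightarrow> 'x"
  assumes i_closed: "x \<in> X \<Longrightarrow> i x \<in> X" and i_i: "x \<in> X \<Longrightarrow> i (i x) = x"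
begin

abbreviation "F \<equiv> free_space K X i"

lemma carrier_F: "carrier F = {f \<in> X \<rightarrow>\<^sub>E carrier K. finite {x \<in> X. f x \<noteq> \<zero>\<^bsub>K\<^esub>}}"
  and zero_F: "\<zero>\<^bsub>F\<^esub> = (\<lambda>x\<in>X. \<zero>\<^bsub>K\<^esub>)"
  and add_F: "f \<oplus>\<^bsub>F\<^esub> g = (\<lambda>x\<in>X. f x \<oplus>\<^bsub>K\<^esub> g x)"
  and smult_F: "c \<odot>\<^bsub>F\<^esub> f = (\<lambda>x\<in>X. c \<otimes>\<^bsub>K\<^esub> f x)"
  and star_F: "star F f = (\<lambda>x\<in>X. f (i x))"
  by (simp_all add: free_space_def)

lemma F_value: "f \<in> carrier F \<Longrightarrow> x \<in> X \<Longrightarrow> f x \<in> carrier K"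
  by (auto simp: carrier_F)

lemma F_support: "f \<in> carrier F \<Longrightarrow> finite {x \<in> X. f x \<noteq> \<zero>\<^bsub>K\<^esub>}"
  by (auto simp: carrier_F)

lemma F_eqI: "\<lbrakk>f \<in> carrier F; g \<in> carrier F; \<And>x. x \<in> X \<Longrightarrow> f x = g x\<rbrakk> \<Longrightarrow> f = g"
  by (auto simp: carrier_F intro: PiE_ext)

text \<open>It suffices to name some finite set off which \<open>f\<close> vanishes; the exact
  support of a sum or of a reindexed function need not be computed.\<close>

lemma F_memI:
  assumes "\<And>x. x \<in> X \<Longrightarrow> f x \<in> carrier K" "finite S" "\<And>x. x \<in> X \<Longrightarrow> x \<notin> S \<Longrightarrow> f x = \<zero>\<^bsub>K\<^esub>"
  shows "restrict f X \<in> carrier F"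
proof -
  have "{x \<in> X. restrict f X x \<noteq> \<zero>\<^bsub>K\<^esub>} \<subseteq> S" using assms(3) by auto
  then have "finite {x \<in> X. restrict f X x \<noteq> \<zero>\<^bsub>K\<^esub>}"
    using assms(2) by (rule finite_subset)
  with assms(1) show ?thesis by (simp add: carrier_F PiE_iff)
qed

lemma F_add_closed: "\<lbrakk>f \<in> carrier F; g \<in> carrier F\<rbrakk> \<Longrightarrow> f \<oplus>\<^bsub>F\<^esub> g \<in> carrier F"
  unfolding add_F
  by (rule F_memI[where S = "{x \<in> X. f x \<noteq> \<zero>\<^bsub>K\<^esub>} \<union> {x \<in> X. g x \<noteq> \<zero>\<^bsub>K\<^esub>}"])
    (auto simp: F_value F_support)

lemma F_smult_closed: "\<lbrakk>c \<in> carrier K; f \<in> carrier F\<rbrakk> \<Longrightarrow> c \<odot>\<^bsub>F\<^esub> f \<in> carrier F"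
  unfolding smult_F
  by (rule F_memI[where S = "{x \<in> X. f x \<noteq> \<zero>\<^bsub>K\<^esub>}"]) (auto simp: F_value F_support)

lemma F_zero_closed: "\<zero>\<^bsub>F\<^esub> \<in> carrier F"
  unfolding zero_F by (rule F_memI[where S = "{}"]) auto

lemma F_star_closed: "f \<in> carrier F \<Longrightarrow> star F f \<in> carrier F"
  unfolding star_F
proof (rule F_memI[where S = "i ` {x \<in> X. f x \<noteq> \<zero>\<^bsub>K\<^esub>}"])
  \<comment> \<open>As \<open>i\<close> is its own inverse, f(i x) can be nonzero only if x is the
    \<open>i\<close>-image of a point of the support of f.\<close>
  fix x assume "x \<in> X" "x \<notin> i ` {x \<in> X. f x \<noteq> \<zero>\<^bsub>K\<^esub>}"
  then show "f (i x) = \<zero>\<^bsub>K\<^esub>" using i_closed[of x] i_i[of x] by force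
qed (auto simp: F_value F_support i_closed)

sublocale F: involutive_space K F
proof -
  note cl = F_add_closed F_smult_closed F_zero_closed F_star_closed F_value i_closed i_i
  note ops = zero_F add_F smult_F star_F
  have "abelian_group F"
  proof (rule abelian_groupI)
    fix f assume f: "f \<in> carrier F"
    \<comment> \<open>The negative is written as the multiple by -1, so finiteness of its support is
      already known from \<open>F_smult_closed\<close>.\<close>
    have "(\<ominus>\<^bsub>K\<^esub> \<one>\<^bsub>K\<^esub>) \<odot>\<^bsub>F\<^esub> f \<oplus>\<^bsub>F\<^esub> f = \<zero>\<^bsub>F\<^esub>"
      using f by (intro F_eqI F_add_closed F_smult_closed F_zero_closed)
        (auto simp: ops F_value l_minus l_neg)
    then show "\<exists>g\<in>carrier F. g \<oplus>\<^bsub>F\<^esub> f = \<zero>\<^bsub>F\<^esub>"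
      using f F_smult_closed by blast
    show "\<zero>\<^bsub>F\<^esub> \<oplus>\<^bsub>F\<^esub> f = f"
      using f by (intro F_eqI cl) (auto simp: ops F_value)
  next
    fix f g h assume "f \<in> carrier F" "g \<in> carrier F" "h \<in> carrier F"
    then show "f \<oplus>\<^bsub>F\<^esub> g \<oplus>\<^bsub>F\<^esub> h = f \<oplus>\<^bsub>F\<^esub> (g \<oplus>\<^bsub>F\<^esub> h)"
      by (intro F_eqI cl) (auto simp: ops F_value a_assoc)
  qed (auto simp: cl intro!: F_eqI, auto simp: ops F_value a_comm)
  moreover have "module_axioms K F"
    by unfold_locales (auto simp: cl intro!: F_eqI,
      auto simp: ops F_value l_distr r_distr m_assoc)
  moreover have "involutive_space_axioms K F"
    by unfold_locales (auto simp: cl intro!: F_eqI, auto simp: ops F_value i_closed i_i)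
  ultimately show "involutive_space K F"
    by (intro involutive_space.intro module.intro cring_axioms)
qed

lemma basis_closed: "x \<in> X \<Longrightarrow> basis K X x \<in> carrier F"
  unfolding basis_def by (rule F_memI[where S = "{x}"]) auto

lemma star_basis: "x \<in> X \<Longrightarrow> star F (basis K X x) = basis K X (i x)"
  using i_i i_closed by (auto simp: star_F basis_def intro!: restrict_ext)

lemma lin_span_basis: "lin_span K F (basis K X ` X) = carrier F"
proof
  have b: "basis K X ` X \<subseteq> carrier F" using basis_closed by auto
  let ?H = "lin_span K F (basis K X ` X)"
  note H = F.submodule_lin_span[OF b]
  show "?H \<subseteq> carrier F" using F.submoduleE(1)[OF H] .
  have zero: "\<zero>\<^bsub>F\<^esub> \<in> ?H"
    using H by (metis submodule_def subgroup.one_closed monoid.select_convs(2))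
  have "f \<in> ?H" if "finite S" "f \<in> carrier F" "\<And>x. x \<in> X \<Longrightarrow> x \<notin> S \<Longrightarrow> f x = \<zero>\<^bsub>K\<^esub>" for S f
    using that
  proof (induction S arbitrary: f rule: finite_induct)
    case empty
    then have "f = \<zero>\<^bsub>F\<^esub>" by (intro F_eqI F_zero_closed) (auto simp: zero_F)
    then show ?case using zero by simp
  next
    case (insert x S)
    show ?case
    proof (cases "x \<in> X")
      case False
      then show ?thesis using insert.IH[OF insert.prems(1)] insert.prems(2) by blast
    next
      case True
      let ?g = "\<lambda>y\<in>X. if y = x then \<zero>\<^bsub>K\<^esub> else f y"
      have g: "?g \<in> carrier F"
        by (rule F_memI[where S = S]) (use insert in \<open>auto simp: F_value\<close>)
      have eq: "f = ?g \<oplus>\<^bsub>F\<^esub> f x \<odot>\<^bsub>F\<^esub> basis K X x"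
        using insert.prems(1) True g
        by (intro F_eqI F_add_closed F_smult_closed basis_closed)
          (auto simp: F_value add_F smult_F basis_def)
      have "?g \<in> ?H"
        by (rule insert.IH[OF g]) (use insert.prems in auto)
      moreover have "basis K X x \<in> ?H"
        using F.lin_span_superset True by blast
      ultimately show ?thesis
        by (subst eq) (intro F.submoduleE(4,5)[OF H] F_value[OF insert.prems(1) True])
    qed
  qed
  from this[OF F_support] show "carrier F \<subseteq> ?H" by blast
qed

text \<open>\<open>free_lift\<close> sums over the support of its argument, which changes under
  addition, scaling and the involution. The fact \<open>eq\<close> frees the index set: any finite
  subset of \<open>X\<close> containing the support gives the same value, so two sums can be
  compared over one common set.\<close>

lemma
  assumes W: "involutive_space K W" and g: "\<And>x. x \<in> X \<Longrightarrow> g x \<in> carrier W"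
    and star: "\<And>x. x \<in> X \<Longrightarrow> g (i x) = star W (g x)"
  shows free_lift_hom: "free_lift K X W g \<in> ivs_hom K F W"
    and free_lift_basis: "x \<in> X \<Longrightarrow> free_lift K X W g (basis K X x) = g x"
proof -
  interpret W: involutive_space K W by fact
  have eq: "free_lift K X W g f = (\<Oplus>\<^bsub>W\<^esub>x\<in>S. f x \<odot>\<^bsub>W\<^esub> g x)"
    if "f \<in> carrier F" "finite S" "S \<subseteq> X" "{x \<in> X. f x \<noteq> \<zero>\<^bsub>K\<^esub>} \<subseteq> S" for f S
    unfolding free_lift_def
    by (rule W.M.add.finprod_mono_neutral_cong_left)
      (use that g in \<open>auto simp: F_value subset_iff\<close>)
  show "free_lift K X W g (basis K X x) = g x" if "x \<in> X"
  proof -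
    have "{y \<in> X. basis K X x y \<noteq> \<zero>\<^bsub>K\<^esub>} \<subseteq> {x}" by (auto simp: basis_def)
    moreover have "basis K X x x = \<one>\<^bsub>K\<^esub>" using that by (simp add: basis_def)
    ultimately show ?thesis
      using that g eq[OF basis_closed[OF that], of "{x}"] by (simp add: W.M.finsum_insert)
  qed
  show "free_lift K X W g \<in> ivs_hom K F W"
  proof (rule ivs_homI)
    fix f assume f: "f \<in> carrier F"
    show "free_lift K X W g f \<in> carrier W"
      unfolding free_lift_def using f g by (intro W.M.finsum_closed) (auto simp: F_value)
    { fix h assume h: "h \<in> carrier F"
      let ?S = "{x \<in> X. f x \<noteq> \<zero>\<^bsub>K\<^esub>} \<union> {x \<in> X. h x \<noteq> \<zero>\<^bsub>K\<^esub>}"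
      have S: "finite ?S" "?S \<subseteq> X" using f h by (auto simp: F_support)
      have sub: "\<And>x. x \<in> ?S \<Longrightarrow> x \<in> X" by auto
      have "free_lift K X W g (f \<oplus>\<^bsub>F\<^esub> h) = (\<Oplus>\<^bsub>W\<^esub>x\<in>?S. (f \<oplus>\<^bsub>F\<^esub> h) x \<odot>\<^bsub>W\<^esub> g x)"
        using f h by (intro eq F_add_closed S) (auto simp: add_F)
      also have "\<dots> = (\<Oplus>\<^bsub>W\<^esub>x\<in>?S. f x \<odot>\<^bsub>W\<^esub> g x \<oplus>\<^bsub>W\<^esub> h x \<odot>\<^bsub>W\<^esub> g x)"
        using f h g by (intro W.M.finsum_cong') (auto dest!: sub simp: add_F F_value W.smult_l_distr)
      also have "\<dots> = (\<Oplus>\<^bsub>W\<^esub>x\<in>?S. f x \<odot>\<^bsub>W\<^esub> g x) \<oplus>\<^bsub>W\<^esub> (\<Oplus>\<^bsub>W\<^esub>x\<in>?S. h x \<odot>\<^bsub>W\<^esub> g x)"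
        using f h g by (intro W.M.finsum_addf) (auto simp: F_value)
      also have "\<dots> = free_lift K X W g f \<oplus>\<^bsub>W\<^esub> free_lift K X W g h"
        using eq[OF f S] eq[OF h S] by auto
      finally show "free_lift K X W g (f \<oplus>\<^bsub>F\<^esub> h) = free_lift K X W g f \<oplus>\<^bsub>W\<^esub> free_lift K X W g h" . }
    { fix c assume c: "c \<in> carrier K"
      let ?S = "{x \<in> X. f x \<noteq> \<zero>\<^bsub>K\<^esub>}"
      have S: "finite ?S" "?S \<subseteq> X" using f by (auto simp: F_support)
      show "free_lift K X W g (c \<odot>\<^bsub>F\<^esub> f) = c \<odot>\<^bsub>W\<^esub> free_lift K X W g f"
        using c f g S
        by (subst (1 2) eq[where S = ?S])
          (auto simp: smult_F F_smult_closed[unfolded smult_F] F_value subset_iff W.smult_assoc1 Pi_iff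
            W.finsum_smult_ldistr intro!: W.M.finsum_cong') }
    interpret s: ivs_linear K W W "star W" by (rule W.ivs_linear_star)
    \<comment> \<open>The union makes the index set stable under \<open>i\<close>, so the sum for
      the starred function can be reindexed along \<open>i\<close>.\<close>
    let ?S = "{x \<in> X. f x \<noteq> \<zero>\<^bsub>K\<^esub>} \<union> i ` {x \<in> X. f x \<noteq> \<zero>\<^bsub>K\<^esub>}"
    have S: "finite ?S" "?S \<subseteq> X" using f by (auto simp: F_support i_closed)
    have "i ` i ` {x \<in> X. f x \<noteq> \<zero>\<^bsub>K\<^esub>} = {x \<in> X. f x \<noteq> \<zero>\<^bsub>K\<^esub>}"
      unfolding image_image by (simp add: i_i)
    then have iS: "i ` ?S = ?S" unfolding image_Un by blast
    have inj: "inj_on i ?S" by (rule inj_on_inverseI[of _ i]) (auto simp: i_i i_closed)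
    have supp: "{x \<in> X. star F f x \<noteq> \<zero>\<^bsub>K\<^esub>} \<subseteq> ?S"
    proof
      fix x assume "x \<in> {x \<in> X. star F f x \<noteq> \<zero>\<^bsub>K\<^esub>}"
      then have "i x \<in> {x \<in> X. f x \<noteq> \<zero>\<^bsub>K\<^esub>}" and x: "i (i x) = x"
        by (auto simp: star_F i_i i_closed)
      from imageI[OF this(1), of i] show "x \<in> ?S" unfolding x by (rule UnI2)
    qed
    have "free_lift K X W g (star F f) = (\<Oplus>\<^bsub>W\<^esub>x\<in>i ` ?S. f (i x) \<odot>\<^bsub>W\<^esub> g x)"
      unfolding iS using f g S supp
      by (subst eq[where S = ?S]) (auto simp: star_F F_star_closed[unfolded star_F] F_value i_closed intro!: W.M.finsum_cong')
    also have "\<dots> = (\<Oplus>\<^bsub>W\<^esub>x\<in>?S. f (i (i x)) \<odot>\<^bsub>W\<^esub> g (i x))"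
      using f g S inj by (intro W.M.finsum_reindex) (auto simp: F_value i_closed i_i)
    also have "\<dots> = (\<Oplus>\<^bsub>W\<^esub>x\<in>?S. star W (f x \<odot>\<^bsub>W\<^esub> g x))"
      using f g S by (intro W.M.finsum_cong') (auto simp: F_value i_closed i_i star W.star_smult W.star_star)
    also have "\<dots> = star W (free_lift K X W g f)"
      unfolding eq[OF f S Un_upper1] using f g subsetD[OF S(2)]
      by (intro s.hom_finsum[symmetric] S(1) W.smult_closed F_value) blast+
    finally show "free_lift K X W g (star F f) = star W (free_lift K X W g f)" .
  qed
qed

end

section \<open>Sums, pushouts and tensor products\<close>

locale ivs_pair = V: involutive_space K V + W: involutive_space K W
  for K :: "('k, 'e) ring_scheme" and V :: "('k, 'v, 'f) ivs_scheme"
    and W :: "('k, 'w, 'g) ivs_scheme"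
begin

lemma dsum_simps [simp]:
  "carrier (dsum V W) = carrier V \<times> carrier W"
  "\<zero>\<^bsub>dsum V W\<^esub> = (\<zero>\<^bsub>V\<^esub>, \<zero>\<^bsub>W\<^esub>)"
  "(v, w) \<oplus>\<^bsub>dsum V W\<^esub> (v', w') = (v \<oplus>\<^bsub>V\<^esub> v', w \<oplus>\<^bsub>W\<^esub> w')"
  "c \<odot>\<^bsub>dsum V W\<^esub> (v, w) = (c \<odot>\<^bsub>V\<^esub> v, c \<odot>\<^bsub>W\<^esub> w)"
  "star (dsum V W) (v, w) = (star V v, star W w)"
  by (simp_all add: dsum_def)

lemma involutive_space_dsum: "involutive_space K (dsum V W)"
proof -
  have "abelian_group (dsum V W)"
  proof (rule abelian_groupI)
    fix x assume "x \<in> carrier (dsum V W)"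
    then show "\<exists>y\<in>carrier (dsum V W). y \<oplus>\<^bsub>dsum V W\<^esub> x = \<zero>\<^bsub>dsum V W\<^esub>"
      by (intro bexI[of _ "(\<ominus>\<^bsub>V\<^esub> fst x, \<ominus>\<^bsub>W\<^esub> snd x)"]) (auto simp: V.M.l_neg W.M.l_neg)
  qed (auto simp: V.M.a_ac W.M.a_ac)
  moreover have "module_axioms K (dsum V W)"
    by unfold_locales
      (auto simp: V.smult_l_distr W.smult_l_distr V.smult_r_distr W.smult_r_distr
        V.smult_assoc1 W.smult_assoc1)
  moreover have "involutive_space_axioms K (dsum V W)"
    by unfold_locales
      (auto simp: V.star_closed W.star_closed V.star_add W.star_add V.star_smult W.star_smult
        V.star_star W.star_star)
  ultimately show ?thesis
    by (intro involutive_space.intro module.intro V.R.cring_axioms)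
qed

sublocale D: involutive_space K "dsum V W"
  by (rule involutive_space_dsum)

lemma dsum_minus:
  assumes "v \<in> carrier V" "w \<in> carrier W" "v' \<in> carrier V" "w' \<in> carrier W"
  shows "(v, w) \<ominus>\<^bsub>dsum V W\<^esub> (v', w') = (v \<ominus>\<^bsub>V\<^esub> v', w \<ominus>\<^bsub>W\<^esub> w')"
proof -
  have "\<ominus>\<^bsub>dsum V W\<^esub> (v', w') = (\<ominus>\<^bsub>V\<^esub> v', \<ominus>\<^bsub>W\<^esub> w')"
    using assms by (intro D.M.minus_equality) (simp_all add: V.M.l_neg W.M.l_neg)
  then show ?thesis by (simp add: a_minus_def)
qed

end

lemma map_prod_ivs_hom:
  assumes "f \<in> ivs_hom K V V'" "g \<in> ivs_hom K W W'"
  shows "map_prod f g \<in> ivs_hom K (dsum V W) (dsum V' W')"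
  using ivs_homD[OF assms(1)] ivs_homD[OF assms(2)]
  by (intro ivs_homI) (auto simp: dsum_def)

lemma dsum_sum_hom:
  assumes Z: "involutive_space K Z" and f: "f \<in> ivs_hom K V Z" and g: "g \<in> ivs_hom K W Z"
  shows "(\<lambda>(v, w). f v \<oplus>\<^bsub>Z\<^esub> g w) \<in> ivs_hom K (dsum V W) Z"
proof -
  interpret Z: involutive_space K Z by fact
  show ?thesis
    using ivs_homD[OF f] ivs_homD[OF g]
    by (intro ivs_homI) (auto simp: dsum_def Z.smult_r_distr Z.star_add Z.M.a_ac)
qed

locale ivs_span = U: involutive_space K U + ivs_pair K V W
  for K :: "('k, 'e) ring_scheme" and V :: "('k, 'v, 'f) ivs_scheme"
    and U :: "('k, 'u, 'h) ivs_scheme" and W :: "('k, 'w, 'g) ivs_scheme" +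
  fixes f :: "'u \<Rightarrow> 'v" and g :: "'u \<Rightarrow> 'w"
  assumes f: "f \<in> ivs_hom K U V" and g: "g \<in> ivs_hom K U W"
begin

sublocale f: ivs_linear K U V f by unfold_locales (rule f)
sublocale g: ivs_linear K U W g by unfold_locales (rule g)

sublocale P: ivs_quotient K "dsum V W" "pushout_rel U W f g"
proof
  show "pushout_rel U W f g \<subseteq> carrier (dsum V W)"
    by (auto simp: pushout_rel_def)
  fix r assume "r \<in> pushout_rel U W f g"
  then obtain u where u: "u \<in> carrier U" "r = (f u, \<ominus>\<^bsub>W\<^esub> g u)"
    by (auto simp: pushout_rel_def)
  interpret s: ivs_linear K W W "star W" by (rule W.ivs_linear_star)
  have "star (dsum V W) r = (f (star U u), \<ominus>\<^bsub>W\<^esub> g (star U u))"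
    using u by (simp add: f.hom_star g.hom_star)
  then have "star (dsum V W) r \<in> pushout_rel U W f g"
    using u by (auto simp: pushout_rel_def U.star_closed)
  then show "star (dsum V W) r \<in> lin_span K (dsum V W) (pushout_rel U W f g)"
    using D.lin_span_superset by blast
qed

lemma pushout_inl_hom: "pushout_inl K V U W f g \<in> ivs_hom K V (pushout K V U W f g)"
proof -
  interpret z: ivs_linear K W W "star W" by (rule W.ivs_linear_star)
  have "(\<lambda>v. (v, \<zero>\<^bsub>W\<^esub>)) \<in> ivs_hom K V (dsum V W)"
    by (intro ivs_homI) auto
  from ivs_hom_comp[OF this P.cls.hom] show ?thesis
    unfolding pushout_inl_def[abs_def] pushout_def .
qed

text \<open>The difference of the two representatives is exactly the relation given by
  \<open>u\<close>. Thus a second component in the image of \<open>g\<close> can be moved into the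
  first; when \<open>g\<close> is onto, as for the coinvariants, every class of the pushout comes
  from the first corner.\<close>

lemma pushout_cls_eq_inl:
  assumes "v \<in> carrier V" "u \<in> carrier U"
  shows "P.cls (v, g u) = pushout_inl K V U W f g (v \<oplus>\<^bsub>V\<^esub> f u)"
proof -
  have "(v \<oplus>\<^bsub>V\<^esub> f u, \<zero>\<^bsub>W\<^esub>) \<ominus>\<^bsub>dsum V W\<^esub> (v, g u) = (f u, \<ominus>\<^bsub>W\<^esub> g u)"
    using assms V.M.a_comm[of v "f u"]
    by (subst dsum_minus) (auto simp: a_minus_def V.M.a_assoc V.M.r_neg)
  then have "P.cls (v \<oplus>\<^bsub>V\<^esub> f u, \<zero>\<^bsub>W\<^esub>) = P.cls (v, g u)"
    using assms by (intro P.cls_eqI) (auto simp: pushout_rel_def)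
  then show ?thesis by (simp add: pushout_inl_def)
qed

text \<open>The compatible pair \<open>a\<close>, \<open>b\<close> gives a map on the sum that kills
  the relations. Its values on the first corner are recorded because in the application every class
  comes from that corner.\<close>

lemma pushout_lift_inl:
  assumes Z: "involutive_space K Z" and a: "a \<in> ivs_hom K V Z" and b: "b \<in> ivs_hom K W Z"
    and comm: "\<And>u. u \<in> carrier U \<Longrightarrow> a (f u) = b (g u)"
    and v: "v \<in> carrier V"
  shows "quot_lift (\<lambda>(v, w). a v \<oplus>\<^bsub>Z\<^esub> b w) (pushout_inl K V U W f g v) = a v"
proof -
  interpret a: ivs_linear K V Z a
    using Z a by (simp add: ivs_linear_def ivs_linear_axioms_def V.involutive_space_axioms)
  interpret b: ivs_linear K W Z b by unfold_locales (rule b)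
  have rel: "(\<lambda>(v, w). a v \<oplus>\<^bsub>Z\<^esub> b w) r = \<zero>\<^bsub>Z\<^esub>" if "r \<in> pushout_rel U W f g" for r
    using that by (auto simp: pushout_rel_def comm a.W.M.r_neg)
  show ?thesis
    unfolding pushout_inl_def using v by (subst P.quot_lift_eq[OF Z dsum_sum_hom[OF Z a b] rel]) auto
qed

end

section \<open>Tensor products over the ground ring\<close>

context ivs_pair
begin

sublocale free: free_ivs K "carrier V \<times> carrier W" "map_prod (star V) (star W)"
  rewrites "free_space K (carrier V \<times> carrier W) (map_prod (star V) (star W)) = free_pairs K V W"
  by unfold_locales (auto simp: free_pairs_def V.star_closed W.star_closed V.star_star W.star_star)

abbreviation "b v w \<equiv> basis K (carrier V \<times> carrier W) (v, w)"

lemma b_closed: "\<lbrakk>v \<in> carrier V; w \<in> carrier W\<rbrakk> \<Longrightarrow> b v w \<in> carrier (free_pairs K V W)"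
  by (intro free.basis_closed) simp

lemma star_b:
  "\<lbrakk>v \<in> carrier V; w \<in> carrier W\<rbrakk> \<Longrightarrow> star (free_pairs K V W) (b v w) = b (star V v) (star W w)"
  by (simp add: free.star_basis)

lemma bilin_relI:
  "\<lbrakk>v \<in> carrier V; v' \<in> carrier V; w \<in> carrier W\<rbrakk> \<Longrightarrow>
    b (v \<oplus>\<^bsub>V\<^esub> v') w \<ominus>\<^bsub>free_pairs K V W\<^esub> (b v w \<oplus>\<^bsub>free_pairs K V W\<^esub> b v' w) \<in> bilin_rel K V W"
  "\<lbrakk>v \<in> carrier V; w \<in> carrier W; w' \<in> carrier W\<rbrakk> \<Longrightarrow>
    b v (w \<oplus>\<^bsub>W\<^esub> w') \<ominus>\<^bsub>free_pairs K V W\<^esub> (b v w \<oplus>\<^bsub>free_pairs K V W\<^esub> b v w') \<in> bilin_rel K V W"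
  "\<lbrakk>c \<in> carrier K; v \<in> carrier V; w \<in> carrier W\<rbrakk> \<Longrightarrow>
    b (c \<odot>\<^bsub>V\<^esub> v) w \<ominus>\<^bsub>free_pairs K V W\<^esub> c \<odot>\<^bsub>free_pairs K V W\<^esub> b v w \<in> bilin_rel K V W"
  "\<lbrakk>c \<in> carrier K; v \<in> carrier V; w \<in> carrier W\<rbrakk> \<Longrightarrow>
    b v (c \<odot>\<^bsub>W\<^esub> w) \<ominus>\<^bsub>free_pairs K V W\<^esub> c \<odot>\<^bsub>free_pairs K V W\<^esub> b v w \<in> bilin_rel K V W"
  unfolding bilin_rel_def Let_def by blast+

lemma bilin_relE:
  assumes "r \<in> bilin_rel K V W"
  obtains (add_left) v v' w where "v \<in> carrier V" "v' \<in> carrier V" "w \<in> carrier W"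
      "r = b (v \<oplus>\<^bsub>V\<^esub> v') w \<ominus>\<^bsub>free_pairs K V W\<^esub> (b v w \<oplus>\<^bsub>free_pairs K V W\<^esub> b v' w)"
    | (add_right) v w w' where "v \<in> carrier V" "w \<in> carrier W" "w' \<in> carrier W"
      "r = b v (w \<oplus>\<^bsub>W\<^esub> w') \<ominus>\<^bsub>free_pairs K V W\<^esub> (b v w \<oplus>\<^bsub>free_pairs K V W\<^esub> b v w')"
    | (smult_left) c v w where "c \<in> carrier K" "v \<in> carrier V" "w \<in> carrier W"
      "r = b (c \<odot>\<^bsub>V\<^esub> v) w \<ominus>\<^bsub>free_pairs K V W\<^esub> c \<odot>\<^bsub>free_pairs K V W\<^esub> b v w"
    | (smult_right) c v w where "c \<in> carrier K" "v \<in> carrier V" "w \<in> carrier W"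
      "r = b v (c \<odot>\<^bsub>W\<^esub> w) \<ominus>\<^bsub>free_pairs K V W\<^esub> c \<odot>\<^bsub>free_pairs K V W\<^esub> b v w"
  using assms unfolding bilin_rel_def Let_def
  by (elim UnE CollectE exE conjE) (rule that; assumption)+

text \<open>The involution preserves each of the four families of relations: the scalar stays and
  the vectors are starred.\<close>

sublocale T: ivs_quotient K "free_pairs K V W" "bilin_rel K V W"
proof
  note cl = b_closed V.star_closed W.star_closed
  show "bilin_rel K V W \<subseteq> carrier (free_pairs K V W)"
    by (auto elim!: bilin_relE simp: b_closed)
  fix r assume "r \<in> bilin_rel K V W"
  interpret s: ivs_linear K "free_pairs K V W" "free_pairs K V W" "star (free_pairs K V W)"
    by (rule free.F.ivs_linear_star)
  from \<open>r \<in> bilin_rel K V W\<close> have "star (free_pairs K V W) r \<in> bilin_rel K V W"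
    by (cases rule: bilin_relE)
      (auto simp: s.hom_minus s.hom_add s.hom_smult star_b cl V.star_add W.star_add V.star_smult
        W.star_smult intro!: bilin_relI)
  then show "star (free_pairs K V W) r \<in> lin_span K (free_pairs K V W) (bilin_rel K V W)"
    using free.F.lin_span_superset by blast
qed

lemma involutive_space_tensor_k: "involutive_space K (tensor_k K V W)"
  unfolding tensor_k_def by (rule T.Q.involutive_space_axioms)

lemma pure_k_closed: "\<lbrakk>v \<in> carrier V; w \<in> carrier W\<rbrakk> \<Longrightarrow> pure_k K V W v w \<in> carrier (tensor_k K V W)"
  unfolding tensor_k_def pure_k_def by (intro T.cls.hom_closed b_closed)

lemma star_pure_k:
  "\<lbrakk>v \<in> carrier V; w \<in> carrier W\<rbrakk> \<Longrightarrow>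
    star (tensor_k K V W) (pure_k K V W v w) = pure_k K V W (star V v) (star W w)"
  unfolding tensor_k_def pure_k_def by (simp add: star_b b_closed flip: T.cls_star)

lemma pure_k_add_right:
  "\<lbrakk>v \<in> carrier V; w \<in> carrier W; w' \<in> carrier W\<rbrakk> \<Longrightarrow>
    pure_k K V W v (w \<oplus>\<^bsub>W\<^esub> w') = pure_k K V W v w \<oplus>\<^bsub>tensor_k K V W\<^esub> pure_k K V W v w'"
  unfolding tensor_k_def pure_k_def
  by (simp add: T.cls_eqI[OF bilin_relI(2)] b_closed T.cls.hom_smult)

lemma pure_k_smult_right:
  "\<lbrakk>c \<in> carrier K; v \<in> carrier V; w \<in> carrier W\<rbrakk> \<Longrightarrow>
    pure_k K V W v (c \<odot>\<^bsub>W\<^esub> w) = c \<odot>\<^bsub>tensor_k K V W\<^esub> pure_k K V W v w"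
  unfolding tensor_k_def pure_k_def
  by (simp add: T.cls_eqI[OF bilin_relI(4)] b_closed T.cls.hom_smult)

lemma lin_span_pure_k:
  "lin_span K (tensor_k K V W) {pure_k K V W v w | v w. v \<in> carrier V \<and> w \<in> carrier W} =
    carrier (tensor_k K V W)"
proof -
  have "{pure_k K V W v w | v w. v \<in> carrier V \<and> w \<in> carrier W} =
      T.cls ` basis K (carrier V \<times> carrier W) ` (carrier V \<times> carrier W)"
    by (auto simp: pure_k_def)
  then show ?thesis
    unfolding tensor_k_def using free.basis_closed
    by (simp only:) (intro T.lin_span_cls free.lin_span_basis, auto)
qed

end

text \<open>\<open>bil_star\<close> refers to the involution acting on both factors at once, the one
  that descends to all the later quotients.\<close>

locale ivs_bilinear = ivs_pair K V W + U: involutive_space K U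
  for K :: "('k, 'e) ring_scheme" and V :: "('k, 'v, 'f) ivs_scheme"
    and W :: "('k, 'w, 'g) ivs_scheme" and U :: "('k, 'u, 'h) ivs_scheme" +
  fixes \<beta> :: "'v \<Rightarrow> 'w \<Rightarrow> 'u"
  assumes bil_closed: "\<lbrakk>v \<in> carrier V; w \<in> carrier W\<rbrakk> \<Longrightarrow> \<beta> v w \<in> carrier U"
    and bil_add_left: "\<lbrakk>v \<in> carrier V; v' \<in> carrier V; w \<in> carrier W\<rbrakk> \<Longrightarrow>
      \<beta> (v \<oplus>\<^bsub>V\<^esub> v') w = \<beta> v w \<oplus>\<^bsub>U\<^esub> \<beta> v' w"
    and bil_add_right: "\<lbrakk>v \<in> carrier V; w \<in> carrier W; w' \<in> carrier W\<rbrakk> \<Longrightarrow>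
      \<beta> v (w \<oplus>\<^bsub>W\<^esub> w') = \<beta> v w \<oplus>\<^bsub>U\<^esub> \<beta> v w'"
    and bil_smult_left: "\<lbrakk>c \<in> carrier K; v \<in> carrier V; w \<in> carrier W\<rbrakk> \<Longrightarrow>
      \<beta> (c \<odot>\<^bsub>V\<^esub> v) w = c \<odot>\<^bsub>U\<^esub> \<beta> v w"
    and bil_smult_right: "\<lbrakk>c \<in> carrier K; v \<in> carrier V; w \<in> carrier W\<rbrakk> \<Longrightarrow>
      \<beta> v (c \<odot>\<^bsub>W\<^esub> w) = c \<odot>\<^bsub>U\<^esub> \<beta> v w"
    and bil_star: "\<lbrakk>v \<in> carrier V; w \<in> carrier W\<rbrakk> \<Longrightarrow>
      \<beta> (star V v) (star W w) = star U (\<beta> v w)"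
begin

abbreviation "\<Phi> \<equiv> free_lift K (carrier V \<times> carrier W) U (\<lambda>(v, w). \<beta> v w)"

sublocale \<Phi>: ivs_linear K "free_pairs K V W" U \<Phi>
  by unfold_locales (rule free.free_lift_hom, auto simp: bil_closed bil_star U.involutive_space_axioms)

lemma \<Phi>_b: "\<lbrakk>v \<in> carrier V; w \<in> carrier W\<rbrakk> \<Longrightarrow> \<Phi> (b v w) = \<beta> v w"
  by (subst free.free_lift_basis) (auto simp: bil_closed bil_star U.involutive_space_axioms)

lemma \<Phi>_rel: "r \<in> bilin_rel K V W \<Longrightarrow> \<Phi> r = \<zero>\<^bsub>U\<^esub>"
  by (cases r rule: bilin_relE)
    (auto simp: \<Phi>.hom_minus \<Phi>.hom_add \<Phi>.hom_smult \<Phi>_b b_closed bil_add_left bil_add_right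
      bil_smult_left bil_smult_right bil_closed a_minus_def U.M.r_neg)

lemma tensor_k_lift_hom: "quot_lift \<Phi> \<in> ivs_hom K (tensor_k K V W) U"
  unfolding tensor_k_def
  by (rule T.quot_lift_hom[OF U.involutive_space_axioms \<Phi>.hom \<Phi>_rel])

lemma tensor_k_lift_pure:
  "\<lbrakk>v \<in> carrier V; w \<in> carrier W\<rbrakk> \<Longrightarrow> quot_lift \<Phi> (pure_k K V W v w) = \<beta> v w"
  unfolding pure_k_def
  by (simp add: T.quot_lift_eq[OF U.involutive_space_axioms \<Phi>.hom \<Phi>_rel] b_closed \<Phi>_b)

end

section \<open>Involutive abelianization\<close>

lemma (in abelian_group) minus_diff:
  "\<lbrakk>x \<in> carrier G; y \<in> carrier G\<rbrakk> \<Longrightarrow> \<ominus> (x \<ominus> y) = y \<ominus> x"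
  by (simp add: a_minus_def minus_add minus_minus a_comm)

text \<open>The star of the product star(1) 1 is star(star(1)) = 1, and by \<open>star_mult\<close>
  it is also star(1) star(star(1)) = star(1).\<close>

lemma (in involutive_algebra) star_one: "star A \<one>\<^bsub>A\<^esub> = \<one>\<^bsub>A\<^esub>"
  using star_mult[of "star A \<one>\<^bsub>A\<^esub>" "\<one>\<^bsub>A\<^esub>"] by (simp add: star_closed star_star)

text \<open>The rule for the right action follows from the axiom for the left one by applying it to
  the starred arguments and starring once more.\<close>

lemma (in involutive_bimodule) star_ract:
  assumes "a \<in> carrier A" "m \<in> carrier M"
  shows "star M (ract M m a) = lact M (star A a) (star M m)"
proof -
  have "star M (star M (lact M (star A a) (star M m))) = star M (ract M m a)"
    using assms by (simp add: star_lact star_closed A.star_closed star_star A.star_star)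
  then show ?thesis
    using assms by (simp add: star_closed A.star_closed star_star lact_closed)
qed

section \<open>Tensor products over the two enveloping algebras\<close>

locale ibimod_pair = M: involutive_bimodule K A M + N: involutive_bimodule K A N
  for K :: "('k, 'e) ring_scheme" and A :: "('k, 'a, 'f) ivs_scheme"
    and M :: "('k, 'a, 'm, 'g) ibimod_scheme" and N :: "('k, 'a, 'n, 'h) ibimod_scheme"
begin

sublocale ivs_pair K M N by unfold_locales

abbreviation "t \<equiv> pure_k K M N"

sublocale TK: involutive_space K "tensor_k K M N" by (rule involutive_space_tensor_k)

lemma balance_relI:
  "\<lbrakk>a \<in> carrier A; m \<in> carrier M; n \<in> carrier N\<rbrakk> \<Longrightarrow>
    t (lact M a m) n \<ominus>\<^bsub>tensor_k K M N\<^esub> t m (ract N n a) \<in> balance_rel K A M N"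
  "\<lbrakk>a \<in> carrier A; m \<in> carrier M; n \<in> carrier N\<rbrakk> \<Longrightarrow>
    t (ract M m a) n \<ominus>\<^bsub>tensor_k K M N\<^esub> t m (lact N a n) \<in> balance_rel K A M N"
  unfolding balance_rel_def Let_def by blast+

lemma balance_relE:
  assumes "r \<in> balance_rel K A M N"
  obtains (lact) a m n where "a \<in> carrier A" "m \<in> carrier M" "n \<in> carrier N"
      "r = t (lact M a m) n \<ominus>\<^bsub>tensor_k K M N\<^esub> t m (ract N n a)"
    | (ract) a m n where "a \<in> carrier A" "m \<in> carrier M" "n \<in> carrier N"
      "r = t (ract M m a) n \<ominus>\<^bsub>tensor_k K M N\<^esub> t m (lact N a n)"
  using assms unfolding balance_rel_def Let_def
  by (elim UnE CollectE exE conjE) (rule that; assumption)+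

lemmas bimod_closed = M.lact_closed M.ract_closed N.lact_closed N.ract_closed
  M.star_closed N.star_closed M.A.star_closed

text \<open>Starring exchanges the two families: a relation moving a from the left of m to the right
  of n becomes one moving star(a) from the right of star(m) to the left of star(n).\<close>

sublocale E: ivs_quotient K "tensor_k K M N" "balance_rel K A M N"
proof
  show "balance_rel K A M N \<subseteq> carrier (tensor_k K M N)"
    by (auto elim!: balance_relE simp: pure_k_closed bimod_closed)
  fix r assume "r \<in> balance_rel K A M N"
  interpret s: ivs_linear K "tensor_k K M N" "tensor_k K M N" "star (tensor_k K M N)"
    by (rule TK.ivs_linear_star)
  from \<open>r \<in> balance_rel K A M N\<close> have "star (tensor_k K M N) r \<in> balance_rel K A M N"
    by (cases rule: balance_relE)
      (auto simp: s.hom_minus star_pure_k pure_k_closed bimod_closed M.star_lact N.star_lact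
        M.star_ract N.star_ract intro!: balance_relI)
  then show "star (tensor_k K M N) r \<in> lin_span K (tensor_k K M N) (balance_rel K A M N)"
    using TK.lin_span_superset by blast
qed

abbreviation "e \<equiv> pure_env K A M N"

sublocale EK: involutive_space K "tensor_env K A M N"
  unfolding tensor_env_def by (rule E.Q.involutive_space_axioms)

lemma pure_env_closed:
  "\<lbrakk>m \<in> carrier M; n \<in> carrier N\<rbrakk> \<Longrightarrow> e m n \<in> carrier (tensor_env K A M N)"
  unfolding tensor_env_def pure_env_def by (intro E.cls.hom_closed pure_k_closed)

lemma star_pure_env:
  "\<lbrakk>m \<in> carrier M; n \<in> carrier N\<rbrakk> \<Longrightarrow> star (tensor_env K A M N) (e m n) = e (star M m) (star N n)"
  unfolding tensor_env_def pure_env_def by (simp add: star_pure_k pure_k_closed flip: E.cls_star)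

sublocale I: ivs_quotient K "tensor_env K A M N" "star_rel K A M N"
proof
  show "star_rel K A M N \<subseteq> carrier (tensor_env K A M N)"
    by (auto simp: star_rel_def pure_env_closed bimod_closed)
  fix r assume "r \<in> star_rel K A M N"
  then obtain m n where mn: "m \<in> carrier M" "n \<in> carrier N"
    "r = e (star M m) n \<ominus>\<^bsub>tensor_env K A M N\<^esub> e m (star N n)"
    by (auto simp: star_rel_def)
  interpret s: ivs_linear K "tensor_env K A M N" "tensor_env K A M N" "star (tensor_env K A M N)"
    by (rule EK.ivs_linear_star)
  \<comment> \<open>The double stars are kept on purpose: in this form the element is literally the
    relation belonging to the starred pair.\<close>
  have "star (tensor_env K A M N) r =
      e (star M (star M m)) (star N n) \<ominus>\<^bsub>tensor_env K A M N\<^esub> e (star M m) (star N (star N n))"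
    using mn by (simp add: s.hom_minus star_pure_env pure_env_closed bimod_closed)
  then have "star (tensor_env K A M N) r \<in> star_rel K A M N"
    unfolding star_rel_def using M.star_closed[OF mn(1)] N.star_closed[OF mn(2)]
    by (intro CollectI exI conjI)
  then show "star (tensor_env K A M N) r \<in> lin_span K (tensor_env K A M N) (star_rel K A M N)"
    using EK.lin_span_superset by blast
qed

abbreviation "T' \<equiv> tensor_ienv K A M N"
abbreviation "p \<equiv> pure_ienv K A M N"

sublocale IK: involutive_space K T'
  unfolding tensor_ienv_def by (rule I.Q.involutive_space_axioms)

lemma pure_ienv_closed: "\<lbrakk>m \<in> carrier M; n \<in> carrier N\<rbrakk> \<Longrightarrow> p m n \<in> carrier T'"
  unfolding tensor_ienv_def pure_ienv_def by (intro I.cls.hom_closed pure_env_closed)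

lemma star_pure_ienv:
  "\<lbrakk>m \<in> carrier M; n \<in> carrier N\<rbrakk> \<Longrightarrow> star T' (p m n) = p (star M m) (star N n)"
  unfolding tensor_ienv_def pure_ienv_def
  by (simp add: star_pure_env pure_env_closed flip: I.cls_star)

lemma pure_env_add_right:
  "\<lbrakk>m \<in> carrier M; n \<in> carrier N; n' \<in> carrier N\<rbrakk> \<Longrightarrow>
    e m (n \<oplus>\<^bsub>N\<^esub> n') = e m n \<oplus>\<^bsub>tensor_env K A M N\<^esub> e m n'"
  unfolding tensor_env_def pure_env_def by (simp add: pure_k_add_right pure_k_closed)

lemma pure_env_smult_right:
  "\<lbrakk>c \<in> carrier K; m \<in> carrier M; n \<in> carrier N\<rbrakk> \<Longrightarrow>
    e m (c \<odot>\<^bsub>N\<^esub> n) = c \<odot>\<^bsub>tensor_env K A M N\<^esub> e m n"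
  unfolding tensor_env_def pure_env_def by (simp add: pure_k_smult_right pure_k_closed E.cls.hom_smult)

lemma pure_ienv_add_right:
  "\<lbrakk>m \<in> carrier M; n \<in> carrier N; n' \<in> carrier N\<rbrakk> \<Longrightarrow> p m (n \<oplus>\<^bsub>N\<^esub> n') = p m n \<oplus>\<^bsub>T'\<^esub> p m n'"
  unfolding tensor_ienv_def pure_ienv_def by (simp add: pure_env_add_right pure_env_closed)

lemma pure_ienv_smult_right:
  "\<lbrakk>c \<in> carrier K; m \<in> carrier M; n \<in> carrier N\<rbrakk> \<Longrightarrow> p m (c \<odot>\<^bsub>N\<^esub> n) = c \<odot>\<^bsub>T'\<^esub> p m n"
  unfolding tensor_ienv_def pure_ienv_def
  by (simp add: pure_env_smult_right pure_env_closed I.cls.hom_smult)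

lemma pure_ienv_lact:
  "\<lbrakk>a \<in> carrier A; m \<in> carrier M; n \<in> carrier N\<rbrakk> \<Longrightarrow> p (lact M a m) n = p m (ract N n a)"
  unfolding pure_ienv_def pure_env_def
  by (simp add: E.cls_eqI[OF balance_relI(1)] pure_k_closed bimod_closed)

lemma pure_ienv_ract:
  "\<lbrakk>a \<in> carrier A; m \<in> carrier M; n \<in> carrier N\<rbrakk> \<Longrightarrow> p (ract M m a) n = p m (lact N a n)"
  unfolding pure_ienv_def pure_env_def
  by (simp add: E.cls_eqI[OF balance_relI(2)] pure_k_closed bimod_closed)

text \<open>Together with \<open>star_pure_ienv\<close> this shows that the involution of
  \<open>T'\<close> fixes every pure tensor.\<close>

lemma pure_ienv_star: "\<lbrakk>m \<in> carrier M; n \<in> carrier N\<rbrakk> \<Longrightarrow> p (star M m) n = p m (star N n)"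
  unfolding pure_ienv_def
  by (intro I.cls_eqI) (auto simp: star_rel_def pure_env_closed bimod_closed)

lemma lin_span_pure_ienv:
  "lin_span K T' {p m n | m n. m \<in> carrier M \<and> n \<in> carrier N} = carrier T'"
proof -
  let ?S = "{t m n | m n. m \<in> carrier M \<and> n \<in> carrier N}"
  have S: "?S \<subseteq> carrier (tensor_k K M N)" "E.cls ` ?S \<subseteq> carrier (tensor_env K A M N)"
    using pure_k_closed pure_env_closed by (auto simp: pure_env_def)
  have eq: "{p m n | m n. m \<in> carrier M \<and> n \<in> carrier N} = I.cls ` E.cls ` ?S"
    by (force simp: pure_ienv_def pure_env_def)
  have "lin_span K (tensor_env K A M N) (E.cls ` ?S) = carrier (tensor_env K A M N)"
    unfolding tensor_env_def by (rule E.lin_span_cls[OF S(1) lin_span_pure_k])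
  then show ?thesis
    unfolding eq tensor_ienv_def by (rule I.lin_span_cls[OF S(2)])
qed

end

text \<open>\<open>bil_star\<close> and \<open>bil_star_swap\<close> together force every value of
  the form to be fixed by the involution of \<open>U\<close>, matching the trivial involution of
  \<open>T'\<close>.\<close>

locale ienv_bilinear = ibimod_pair K A M N + ivs_bilinear K M N U \<beta>
  for K :: "('k, 'e) ring_scheme" and A :: "('k, 'a, 'f) ivs_scheme"
    and M :: "('k, 'a, 'm, 'g) ibimod_scheme" and N :: "('k, 'a, 'n, 'h) ibimod_scheme"
    and U :: "('k, 'u, 'i) ivs_scheme" and \<beta> :: "'m \<Rightarrow> 'n \<Rightarrow> 'u" +
  assumes bil_lact: "\<lbrakk>a \<in> carrier A; m \<in> carrier M; n \<in> carrier N\<rbrakk> \<Longrightarrow>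
      \<beta> (lact M a m) n = \<beta> m (ract N n a)"
    and bil_ract: "\<lbrakk>a \<in> carrier A; m \<in> carrier M; n \<in> carrier N\<rbrakk> \<Longrightarrow>
      \<beta> (ract M m a) n = \<beta> m (lact N a n)"
    and bil_star_swap: "\<lbrakk>m \<in> carrier M; n \<in> carrier N\<rbrakk> \<Longrightarrow> \<beta> (star M m) n = \<beta> m (star N n)"
begin

sublocale lift: ivs_linear K "tensor_k K M N" U "quot_lift \<Phi>"
  by unfold_locales (rule tensor_k_lift_hom)

lemma lift_balance: "r \<in> balance_rel K A M N \<Longrightarrow> quot_lift \<Phi> r = \<zero>\<^bsub>U\<^esub>"
  by (cases r rule: balance_relE)
    (auto simp: lift.hom_minus tensor_k_lift_pure pure_k_closed bimod_closed bil_lact bil_ract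
      bil_closed a_minus_def U.M.r_neg)

lemma tensor_env_lift_hom: "quot_lift (quot_lift \<Phi>) \<in> ivs_hom K (tensor_env K A M N) U"
  unfolding tensor_env_def
  by (rule E.quot_lift_hom[OF U.involutive_space_axioms lift.hom lift_balance])

sublocale lift': ivs_linear K "tensor_env K A M N" U "quot_lift (quot_lift \<Phi>)"
  by unfold_locales (rule tensor_env_lift_hom)

lemma tensor_env_lift_pure:
  "\<lbrakk>m \<in> carrier M; n \<in> carrier N\<rbrakk> \<Longrightarrow> quot_lift (quot_lift \<Phi>) (e m n) = \<beta> m n"
  unfolding pure_env_def
  by (simp add: E.quot_lift_eq[OF U.involutive_space_axioms lift.hom lift_balance]
      pure_k_closed tensor_k_lift_pure)

lemma lift_star: "r \<in> star_rel K A M N \<Longrightarrow> quot_lift (quot_lift \<Phi>) r = \<zero>\<^bsub>U\<^esub>"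
  by (auto simp: star_rel_def lift'.hom_minus tensor_env_lift_pure pure_env_closed bimod_closed
      bil_star_swap bil_closed a_minus_def U.M.r_neg)

lemma ienv_lift_hom: "ienv_lift K M N U \<beta> \<in> ivs_hom K T' U"
  unfolding tensor_ienv_def ienv_lift_def
  by (rule I.quot_lift_hom[OF U.involutive_space_axioms lift'.hom lift_star])

lemma ienv_lift_pure: "\<lbrakk>m \<in> carrier M; n \<in> carrier N\<rbrakk> \<Longrightarrow> ienv_lift K M N U \<beta> (p m n) = \<beta> m n"
  unfolding pure_ienv_def ienv_lift_def
  by (simp add: I.quot_lift_eq[OF U.involutive_space_axioms lift'.hom lift_star]
      pure_env_closed tensor_env_lift_pure)

end

lemma regular_simps [simp]:
  "carrier (regular A) = carrier A" "zero (regular A) = zero A" "add (regular A) = add A"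
  "smult (regular A) = smult A" "star (regular A) = star A"
  "lact (regular A) = mult A" "ract (regular A) = mult A"
  by (simp_all add: regular_def)

lemma (in involutive_algebra) involutive_bimodule_regular: "involutive_bimodule K A (regular A)"
proof -
  have "involutive_space K (regular A)"
    by (rule involutive_space_image[OF involutive_space_axioms, where h = "\<lambda>x. x"]) simp_all
  then show ?thesis
    by (intro involutive_bimodule.intro involutive_algebra_axioms involutive_bimodule_axioms.intro)
      (simp_all add: l_distr r_distr m_assoc star_mult flip: smult_mult_left smult_mult_right)
qed

section \<open>Abelianization, coinvariants and the comparison with their pushout\<close>

locale ibimod_quotients = involutive_bimodule K A M
  for K :: "('k, 'e) ring_scheme" and A :: "('k, 'a, 'f) ivs_scheme"
    and M :: "('k, 'a, 'm, 'g) ibimod_scheme"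
begin

sublocale comm: ivs_quotient K M "comm_rel A M"
proof
  show "comm_rel A M \<subseteq> carrier M"
    by (auto simp: comm_rel_def lact_closed ract_closed)
  fix r assume "r \<in> comm_rel A M"
  then obtain a m where am: "a \<in> carrier A" "m \<in> carrier M" "r = lact M a m \<ominus>\<^bsub>M\<^esub> ract M m a"
    by (auto simp: comm_rel_def)
  interpret s: ivs_linear K M M "star M" by (rule ivs_linear_star)
  let ?a = "star A a" and ?m = "star M m"
  have cl: "?a \<in> carrier A" "?m \<in> carrier M" using am by (auto simp: star_closed A.star_closed)
  have "star M r = ract M ?m ?a \<ominus>\<^bsub>M\<^esub> lact M ?a ?m"
    using am by (simp add: s.hom_minus star_lact star_ract lact_closed ract_closed)
  also have "\<dots> = \<ominus>\<^bsub>M\<^esub> (lact M ?a ?m \<ominus>\<^bsub>M\<^esub> ract M ?m ?a)"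
    using cl by (simp add: M.minus_diff lact_closed ract_closed)
  finally have eq: "star M r = \<ominus>\<^bsub>M\<^esub> (lact M ?a ?m \<ominus>\<^bsub>M\<^esub> ract M ?m ?a)" .
  have "lact M ?a ?m \<ominus>\<^bsub>M\<^esub> ract M ?m ?a \<in> comm_rel A M" using cl by (auto simp: comm_rel_def)
  then show "star M r \<in> lin_span K M (comm_rel A M)"
    unfolding eq using submoduleE(3)[OF submodule_lin_span[OF \<open>comm_rel A M \<subseteq> carrier M\<close>]]
      lin_span_superset by blast
qed

sublocale coinv: ivs_quotient K M "coinv_rel M"
proof
  show "coinv_rel M \<subseteq> carrier M"
    by (auto simp: coinv_rel_def star_closed)
  fix r assume "r \<in> coinv_rel M"
  then obtain m where m: "m \<in> carrier M" "r = m \<ominus>\<^bsub>M\<^esub> star M m"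
    by (auto simp: coinv_rel_def)
  interpret s: ivs_linear K M M "star M" by (rule ivs_linear_star)
  have "star M r = star M m \<ominus>\<^bsub>M\<^esub> star M (star M m)"
    using m by (simp add: s.hom_minus star_closed)
  then have "star M r \<in> coinv_rel M" using m by (auto simp: coinv_rel_def star_closed)
  then show "star M r \<in> lin_span K M (coinv_rel M)"
    using lin_span_superset by blast
qed

sublocale span: ivs_span K "Ab K A M" M "Coinv K M" comm.cls coinv.cls
  unfolding Ab_def Coinv_def
  by unfold_locales (rule comm.cls.hom coinv.cls.hom)+

sublocale reg: ibimod_pair K A "regular A" M
  by (intro ibimod_pair.intro A.involutive_bimodule_regular involutive_bimodule_axioms)

abbreviation "j \<equiv> pure_ienv K A (regular A) M \<one>\<^bsub>A\<^esub>"
text \<open>The image of m in the pushout, entered through the abelianization corner; entering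
  through the coinvariants gives the same class.\<close>

abbreviation "\<kappa> m \<equiv> iAb_inl K A M (comm.cls m)"

lemma pure_eq_j: "\<lbrakk>a \<in> carrier A; m \<in> carrier M\<rbrakk> \<Longrightarrow> reg.p a m = j (lact M a m)"
  using reg.pure_ienv_ract[of a "\<one>\<^bsub>A\<^esub>" m] by simp

text \<open>The factor a is both a 1 and 1 a. Moving it across in the first form gives 1 \<otimes> m
  a, in the second 1 \<otimes> a m.\<close>

lemma j_ract: "\<lbrakk>a \<in> carrier A; m \<in> carrier M\<rbrakk> \<Longrightarrow> j (ract M m a) = j (lact M a m)"
  using reg.pure_ienv_lact[of a "\<one>\<^bsub>A\<^esub>" m] by (simp add: pure_eq_j)

lemma j_star: "m \<in> carrier M \<Longrightarrow> j (star M m) = j m"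
  using reg.pure_ienv_star[of "\<one>\<^bsub>A\<^esub>" m] by (simp add: A.star_one)

lemma j_hom: "j \<in> ivs_hom K M (iAb K A M)"
  unfolding iAb_def
  by (intro ivs_homI)
    (simp_all add: reg.pure_ienv_closed reg.pure_ienv_add_right reg.pure_ienv_smult_right
      reg.star_pure_ienv A.star_one)

sublocale iAb: involutive_space K "iAb K A M"
  unfolding iAb_def by (rule reg.IK.involutive_space_axioms)

sublocale j: ivs_linear K M "iAb K A M" j
  by unfold_locales (rule j_hom)

lemma star_j: "m \<in> carrier M \<Longrightarrow> star (iAb K A M) (j m) = j m"
  by (simp add: j_star flip: j.hom_star)

text \<open>A general element is only a combination of pure tensors, but each of these is j(a m),
  and the image of the linear map \<open>j\<close> is already a submodule, so it is
  everything.\<close>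

lemma iAb_eq_j:
  assumes "x \<in> carrier (iAb K A M)"
  obtains m where "m \<in> carrier M" "x = j m"
proof -
  have "submodule (j ` carrier M) K (iAb K A M)"
  proof (rule iAb.submoduleI)
    show "\<zero>\<^bsub>iAb K A M\<^esub> \<in> j ` carrier M" by (rule image_eqI[of _ _ "\<zero>\<^bsub>M\<^esub>"]) simp_all
  qed (auto simp flip: j.gh.hom_a_inv j.hom_add j.hom_smult simp del: j.gh.hom_add j.gh.hom_a_inv)
  then have "carrier (iAb K A M) \<subseteq> j ` carrier M"
    unfolding iAb_def reg.lin_span_pure_ienv[symmetric]
    by (rule reg.IK.lin_span_minimal) (auto simp: pure_eq_j lact_closed)
  with assms that show thesis by blast
qed

sublocale P: involutive_space K "iAb_pushout K A M"
  unfolding iAb_pushout_def pushout_def by (rule span.P.Q.involutive_space_axioms)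

lemma \<kappa>_hom: "(\<lambda>m. \<kappa> m) \<in> ivs_hom K M (iAb_pushout K A M)"
  unfolding iAb_pushout_def iAb_inl_def
  by (rule ivs_hom_comp[OF span.f span.pushout_inl_hom])

sublocale \<kappa>: ivs_linear K M "iAb_pushout K A M" "\<lambda>m. \<kappa> m"
  by unfold_locales (rule \<kappa>_hom)

lemma pushout_cls_eq_\<kappa>:
  assumes "m \<in> carrier M" "n \<in> carrier M"
  shows "span.P.cls (comm.cls m, coinv.cls n) = \<kappa> (m \<oplus>\<^bsub>M\<^esub> n)"
  using span.pushout_cls_eq_inl[of "comm.cls m" n] assms
  by (simp add: iAb_inl_def Ab_def)

lemma \<kappa>_ract: "\<lbrakk>a \<in> carrier A; m \<in> carrier M\<rbrakk> \<Longrightarrow> \<kappa> (ract M m a) = \<kappa> (lact M a m)"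
  by (subst comm.cls_eqI[of "lact M a m" "ract M m a"])
    (auto simp: comm_rel_def lact_closed ract_closed)

text \<open>Seen from the other corner, \<open>\<kappa> m\<close> is the class of the pair of 0 and
  the coinvariant class of m, and m and star(m) have the same coinvariant class.\<close>

lemma \<kappa>_star:
  assumes "m \<in> carrier M"
  shows "\<kappa> (star M m) = \<kappa> m"
proof -
  have "coinv.cls m = coinv.cls (star M m)"
    using assms by (intro coinv.cls_eqI) (auto simp: coinv_rel_def star_closed)
  then show ?thesis
    using pushout_cls_eq_\<kappa>[of "\<zero>\<^bsub>M\<^esub>" m] pushout_cls_eq_\<kappa>[of "\<zero>\<^bsub>M\<^esub>" "star M m"] assms
    by (simp add: star_closed)
qed

text \<open>The conditions on \<open>\<phi>\<close> are exactly what makes the form \<phi>(a m)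
  respect the relations over A^ie, so this is the universal property of \<open>iAb\<close>.
  \<open>\<beta>\<close> is a separate variable so that forms written differently, such as the one
  in \<open>iAb_map\<close>, can be inserted as they stand.\<close>

lemma
  assumes U: "involutive_space K U" and \<phi>: "\<phi> \<in> ivs_hom K M U"
    and \<phi>_ract: "\<And>a m. \<lbrakk>a \<in> carrier A; m \<in> carrier M\<rbrakk> \<Longrightarrow> \<phi> (ract M m a) = \<phi> (lact M a m)"
    and \<phi>_star: "\<And>m. m \<in> carrier M \<Longrightarrow> \<phi> (star M m) = \<phi> m"
    and \<beta>: "\<And>a m. \<lbrakk>a \<in> carrier A; m \<in> carrier M\<rbrakk> \<Longrightarrow> \<beta> a m = \<phi> (lact M a m)"
  shows trace_lift_hom: "ienv_lift K (regular A) M U \<beta> \<in> ivs_hom K (iAb K A M) U"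
    and trace_lift_j: "m \<in> carrier M \<Longrightarrow> ienv_lift K (regular A) M U \<beta> (j m) = \<phi> m"
proof -
  interpret U: involutive_space K U by fact
  interpret \<phi>: ivs_linear K M U \<phi> by unfold_locales (rule \<phi>)
  note cl = lact_closed ract_closed star_closed A.star_closed
  \<comment> \<open>The product star(a) star(m) is the star of m a, so \<phi> first drops the star
    and then turns m a into a m.\<close>
  have swap: "\<phi> (lact M (star A a) (star M m)) = \<phi> (lact M a m)"
    if "a \<in> carrier A" "m \<in> carrier M" for a m
    using that \<phi>_star[of "ract M m a"] by (simp add: star_ract \<phi>_ract cl)
  interpret ienv_bilinear K A "regular A" M U \<beta>
  proof unfold_locales
    fix a m assume am: "a \<in> carrier (regular A)" "m \<in> carrier M"
    then show "\<beta> (star (regular A) a) (star M m) = star U (\<beta> a m)"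
      using \<phi>_star[of "lact M a m"] by (simp add: \<beta> cl swap flip: \<phi>.hom_star)
    show "\<beta> (star (regular A) a) m = \<beta> a (star M m)"
      using am swap[of "a" "star M m"] by (simp add: \<beta> cl star_star)
    fix b assume b: "b \<in> carrier A"
    \<comment> \<open>By the trace condition \<phi>(a (m b)) = \<phi>((a m) b) = \<phi>(b (a
      m)).\<close>
    show "\<beta> (lact (regular A) b a) m = \<beta> a (ract M m b)"
      using am b by (simp add: \<beta> cl lact_mult \<phi>_ract flip: lact_ract)
    show "\<beta> (ract (regular A) a b) m = \<beta> a (lact M b m)"
      using am b by (simp add: \<beta> cl lact_mult)
  qed (simp_all add: \<beta> cl add_lact lact_add smult_lact lact_smult \<phi>.hom_add \<phi>.hom_smult)
  show "ienv_lift K (regular A) M U \<beta> \<in> ivs_hom K (iAb K A M) U"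
    unfolding iAb_def by (rule ienv_lift_hom)
  show "ienv_lift K (regular A) M U \<beta> (j m) = \<phi> m" if "m \<in> carrier M"
    using that ienv_lift_pure[of "\<one>\<^bsub>A\<^esub>" m] by (simp add: \<beta> lact_one)
qed

lemma iAb_compare_hom: "iAb_compare K A M \<in> ivs_hom K (iAb K A M) (iAb_pushout K A M)"
  unfolding iAb_compare_def
  by (rule trace_lift_hom[OF P.involutive_space_axioms \<kappa>_hom]) (simp_all add: \<kappa>_ract \<kappa>_star)

lemma iAb_compare_j: "m \<in> carrier M \<Longrightarrow> iAb_compare K A M (j m) = \<kappa> m"
  unfolding iAb_compare_def
  by (rule trace_lift_j[OF P.involutive_space_axioms \<kappa>_hom]) (simp_all add: \<kappa>_ract \<kappa>_star)

text \<open>This is injectivity of the comparison map in the form in which it is used: since every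
  element of \<open>iAb\<close> is some \<open>j m\<close>, it is enough to evaluate the reverse map
  on the classes \<open>\<kappa> n\<close>.\<close>

lemma j_eq_if_\<kappa>_eq:
  assumes "m \<in> carrier M" "m' \<in> carrier M" "\<kappa> m = \<kappa> m'"
  shows "j m = j m'"
proof -
  have "j r = \<zero>\<^bsub>iAb K A M\<^esub>" if "r \<in> comm_rel A M" for r
    using that by (auto simp: comm_rel_def j.hom_minus j_ract lact_closed ract_closed
      a_minus_def iAb.M.r_neg)
  note comm = iAb.involutive_space_axioms j_hom this
  have "j r = \<zero>\<^bsub>iAb K A M\<^esub>" if "r \<in> coinv_rel M" for r
    using that by (auto simp: coinv_rel_def j.hom_minus j_star star_closed a_minus_def iAb.M.r_neg)
  note coinv = iAb.involutive_space_axioms j_hom this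
  note lift = span.pushout_lift_inl[where a = "quot_lift j" and b = "quot_lift j",
      OF iAb.involutive_space_axioms comm.quot_lift_hom[OF comm, folded Ab_def]
        coinv.quot_lift_hom[OF coinv, folded Coinv_def], folded iAb_inl_def]
  have "quot_lift (\<lambda>(X, Y). quot_lift j X \<oplus>\<^bsub>iAb K A M\<^esub> quot_lift j Y) (\<kappa> n) = j n"
    if "n \<in> carrier M" for n
    using that by (subst lift) (auto simp: comm.quot_lift_eq[OF comm] coinv.quot_lift_eq[OF coinv])
  from this[OF assms(1)] this[OF assms(2)] assms(3) show ?thesis by simp
qed

lemma bij_iAb_compare: "bij_betw (iAb_compare K A M) (carrier (iAb K A M)) (carrier (iAb_pushout K A M))"
proof (rule bij_betwI')
  fix x y assume "x \<in> carrier (iAb K A M)" "y \<in> carrier (iAb K A M)"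
  then obtain m n where "m \<in> carrier M" "x = j m" "n \<in> carrier M" "y = j n"
    by (metis iAb_eq_j)
  then show "iAb_compare K A M x = iAb_compare K A M y \<longleftrightarrow> x = y"
    using j_eq_if_\<kappa>_eq[of m n] iAb_compare_j[of m] iAb_compare_j[of n] by metis
next
  fix x assume "x \<in> carrier (iAb K A M)"
  then show "iAb_compare K A M x \<in> carrier (iAb_pushout K A M)"
    using ivs_homD(1)[OF iAb_compare_hom] by blast
next
  fix y assume "y \<in> carrier (iAb_pushout K A M)"
  then obtain X Y where XY: "X \<in> carrier (Ab K A M)" "Y \<in> carrier (Coinv K M)" "y = span.P.cls (X, Y)"
    unfolding iAb_pushout_def pushout_def by (auto elim!: span.P.carrier_QE)
  then obtain m n where "m \<in> carrier M" "n \<in> carrier M" "X = comm.cls m" "Y = coinv.cls n"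
    unfolding Ab_def Coinv_def by (metis comm.carrier_QE coinv.carrier_QE)
  with XY show "\<exists>x\<in>carrier (iAb K A M). y = iAb_compare K A M x"
    \<comment> \<open>The class of the pair of m and n is \<open>\<kappa>\<close> of m + n, which
      explains the witness.\<close>
    by (intro bexI[of _ "j (m \<oplus>\<^bsub>M\<^esub> n)"]) (auto simp: pushout_cls_eq_\<kappa> iAb_compare_j simp del: j.gh.hom_add)
qed

lemma ivs_iso_iAb_compare: "ivs_iso K (iAb K A M) (iAb_pushout K A M) (iAb_compare K A M)"
  unfolding ivs_iso_def
  using iAb.involutive_space_axioms P.involutive_space_axioms iAb_compare_hom bij_iAb_compare by blast

lemma ivs_iso_iAb_compare_star:
  assumes inv: "involutive_space K ((iAb K A M)\<lparr>star := \<sigma>\<rparr>)"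
    and \<sigma>: "\<And>a m. \<lbrakk>a \<in> carrier A; m \<in> carrier M\<rbrakk> \<Longrightarrow> \<sigma> (reg.p a m) = reg.p (star A a) m"
  shows "ivs_iso K ((iAb K A M)\<lparr>star := \<sigma>\<rparr>) (iAb_pushout K A M) (iAb_compare K A M)"
proof -
  \<comment> \<open>Both involutions are the identity, as \<open>1\<^sup>* = 1\<close> and every element is some \<open>1 \<otimes> m\<close>.\<close>
  have "\<sigma> x = star (iAb K A M) x" if "x \<in> carrier (iAb K A M)" for x
    using that \<sigma>[of "\<one>\<^bsub>A\<^esub>"] by (auto elim!: iAb_eq_j simp: star_j A.star_one)
  then show ?thesis
    using ivs_iso_iAb_compare inv by (simp add: ivs_iso_def ivs_hom_def)
qed

end

section \<open>Naturality and the involutive center\<close>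

lemma ibimod_homD:
  assumes "h \<in> ibimod_hom K A M N"
  shows "h \<in> ivs_hom K M N"
    and "\<lbrakk>a \<in> carrier A; m \<in> carrier M\<rbrakk> \<Longrightarrow> h (lact M a m) = lact N a (h m)"
    and "\<lbrakk>a \<in> carrier A; m \<in> carrier M\<rbrakk> \<Longrightarrow> h (ract M m a) = ract N (h m) a"
  using assms by (auto simp: ibimod_hom_def)

locale ibimod_map = M: ibimod_quotients K A M + N: ibimod_quotients K A N
  for K :: "('k, 'e) ring_scheme" and A :: "('k, 'a, 'f) ivs_scheme"
    and M :: "('k, 'a, 'm, 'g) ibimod_scheme" and N :: "('k, 'a, 'n, 'h) ibimod_scheme" +
  fixes h :: "'m \<Rightarrow> 'n"
  assumes h: "h \<in> ibimod_hom K A M N"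
begin

lemmas h_lact = ibimod_homD(2)[OF h] and h_ract = ibimod_homD(3)[OF h]

sublocale h: ivs_linear K M N h
  by unfold_locales (rule ibimod_homD(1)[OF h])

lemma jh_hom: "(\<lambda>m. N.j (h m)) \<in> ivs_hom K M (iAb K A N)"
  by (rule ivs_hom_comp[OF h.hom N.j_hom])

lemma iAb_map_hom: "iAb_map K A M N h \<in> ivs_hom K (iAb K A M) (iAb K A N)"
  unfolding iAb_map_def
  by (rule M.trace_lift_hom[OF N.iAb.involutive_space_axioms jh_hom])
    (simp_all add: h_lact h_ract h.hom_star N.j_ract N.j_star N.pure_eq_j)

lemma iAb_map_j: "m \<in> carrier M \<Longrightarrow> iAb_map K A M N h (M.j m) = N.j (h m)"
  unfolding iAb_map_def
  by (rule M.trace_lift_j[OF N.iAb.involutive_space_axioms jh_hom])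
    (simp_all add: h_lact h_ract h.hom_star N.j_ract N.j_star N.pure_eq_j)

lemma
  shows Ab_map_hom: "quot_map K N (comm_rel A N) h \<in> ivs_hom K (Ab K A M) (Ab K A N)"
    and Ab_map_cls: "m \<in> carrier M \<Longrightarrow>
      quot_map K N (comm_rel A N) h (M.comm.cls m) = N.comm.cls (h m)"
proof -
  have hom: "(\<lambda>m. N.comm.cls (h m)) \<in> ivs_hom K M N.comm.Q"
    by (rule ivs_hom_comp[OF h.hom N.comm.cls.hom])
  have rel: "N.comm.cls (h r) = \<zero>\<^bsub>N.comm.Q\<^esub>" if "r \<in> comm_rel A M" for r
  proof -
    from that obtain a m where am: "a \<in> carrier A" "m \<in> carrier M"
      and r: "r = lact M a m \<ominus>\<^bsub>M\<^esub> ract M m a" by (auto simp: comm_rel_def)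
    have "h r = lact N a (h m) \<ominus>\<^bsub>N\<^esub> ract N (h m) a"
      unfolding r using am by (simp add: h.hom_minus h_lact h_ract M.lact_closed M.ract_closed)
    then have "h r \<in> comm_rel A N" using am unfolding comm_rel_def by blast
    then show ?thesis
      using N.lin_span_superset N.comm.rel_closed by (subst N.comm.cls_eq_zero_iff) auto
  qed
  show "quot_map K N (comm_rel A N) h \<in> ivs_hom K (Ab K A M) (Ab K A N)"
    unfolding quot_map_def Ab_def
    by (rule M.comm.quot_lift_hom[OF N.comm.Q.involutive_space_axioms hom rel])
  show "quot_map K N (comm_rel A N) h (M.comm.cls m) = N.comm.cls (h m)" if "m \<in> carrier M"
    unfolding quot_map_def
    by (rule M.comm.quot_lift_eq[OF N.comm.Q.involutive_space_axioms hom rel that])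
qed

lemma
  shows Coinv_map_hom: "quot_map K N (coinv_rel N) h \<in> ivs_hom K (Coinv K M) (Coinv K N)"
    and Coinv_map_cls: "m \<in> carrier M \<Longrightarrow>
      quot_map K N (coinv_rel N) h (M.coinv.cls m) = N.coinv.cls (h m)"
proof -
  have hom: "(\<lambda>m. N.coinv.cls (h m)) \<in> ivs_hom K M N.coinv.Q"
    by (rule ivs_hom_comp[OF h.hom N.coinv.cls.hom])
  have rel: "N.coinv.cls (h r) = \<zero>\<^bsub>N.coinv.Q\<^esub>" if "r \<in> coinv_rel M" for r
  proof -
    from that obtain m where m: "m \<in> carrier M" and r: "r = m \<ominus>\<^bsub>M\<^esub> star M m"
      by (auto simp: coinv_rel_def)
    have "h r = h m \<ominus>\<^bsub>N\<^esub> star N (h m)"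
      unfolding r using m by (simp add: h.hom_minus h.hom_star M.star_closed)
    then have "h r \<in> coinv_rel N" using m unfolding coinv_rel_def by blast
    then show ?thesis
      using N.lin_span_superset N.coinv.rel_closed by (subst N.coinv.cls_eq_zero_iff) auto
  qed
  show "quot_map K N (coinv_rel N) h \<in> ivs_hom K (Coinv K M) (Coinv K N)"
    unfolding quot_map_def Coinv_def
    by (rule M.coinv.quot_lift_hom[OF N.coinv.Q.involutive_space_axioms hom rel])
  show "quot_map K N (coinv_rel N) h (M.coinv.cls m) = N.coinv.cls (h m)" if "m \<in> carrier M"
    unfolding quot_map_def
    by (rule M.coinv.quot_lift_eq[OF N.coinv.Q.involutive_space_axioms hom rel that])
qed

lemma
  shows iAb_pushout_map_hom:
      "iAb_pushout_map K A N h \<in> ivs_hom K (iAb_pushout K A M) (iAb_pushout K A N)"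
    and iAb_pushout_map_\<kappa>: "m \<in> carrier M \<Longrightarrow> iAb_pushout_map K A N h (M.\<kappa> m) = N.\<kappa> (h m)"
proof -
  let ?f = "quot_map K N (comm_rel A N) h" and ?g = "quot_map K N (coinv_rel N) h"
  \<comment> \<open>Linearity is needed to carry the map through the minus sign in the second
    component of a pushout relation.\<close>
  interpret g: ivs_linear K "Coinv K M" "Coinv K N" ?g
    by unfold_locales (rule Coinv_map_hom)
  have hom: "(\<lambda>x. N.span.P.cls (map_prod ?f ?g x)) \<in>
      ivs_hom K (dsum (Ab K A M) (Coinv K M)) N.span.P.Q"
    by (rule ivs_hom_comp[OF map_prod_ivs_hom[OF Ab_map_hom Coinv_map_hom] N.span.P.cls.hom])
  have rel: "N.span.P.cls (map_prod ?f ?g r) = \<zero>\<^bsub>N.span.P.Q\<^esub>"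
    if "r \<in> pushout_rel M (Coinv K M) M.comm.cls M.coinv.cls" for r
  proof -
    from that obtain u where u: "u \<in> carrier M"
      and r: "r = (M.comm.cls u, \<ominus>\<^bsub>Coinv K M\<^esub> M.coinv.cls u)" by (auto simp: pushout_rel_def)
    have "map_prod ?f ?g r = (N.comm.cls (h u), \<ominus>\<^bsub>Coinv K N\<^esub> N.coinv.cls (h u))"
      unfolding r using u by (simp add: Ab_map_cls Coinv_map_cls)
    then have "map_prod ?f ?g r \<in> pushout_rel N (Coinv K N) N.comm.cls N.coinv.cls"
      unfolding pushout_rel_def using u by blast
    then show ?thesis
      using N.span.D.lin_span_superset N.span.P.rel_closed
      by (subst N.span.P.cls_eq_zero_iff) auto
  qed
  note lift = N.span.P.Q.involutive_space_axioms hom rel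
  show "iAb_pushout_map K A N h \<in> ivs_hom K (iAb_pushout K A M) (iAb_pushout K A N)"
    unfolding iAb_pushout_map_def iAb_pushout_def pushout_def quot_map_def[of K "dsum _ _"]
    by (rule M.span.P.quot_lift_hom[OF lift])
  show "iAb_pushout_map K A N h (M.\<kappa> m) = N.\<kappa> (h m)" if m: "m \<in> carrier M"
  proof -
    have "(M.comm.cls m, \<zero>\<^bsub>Coinv K M\<^esub>) \<in> carrier (dsum (Ab K A M) (Coinv K M))"
      using m by simp
    from M.span.P.quot_lift_eq[OF lift this] show ?thesis
      unfolding iAb_pushout_map_def iAb_inl_def pushout_inl_def quot_map_def[of K "dsum _ _"]
      using m by (simp add: Ab_map_cls)
  qed
qed

text \<open>Both sides send \<open>M.j m\<close> to \<open>N.\<kappa> (h m)\<close>, and every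
  element of \<open>iAb K A M\<close> has the form \<open>M.j m\<close>.\<close>

lemma iAb_compare_natural:
  assumes "x \<in> carrier (iAb K A M)"
  shows "iAb_compare K A N (iAb_map K A M N h x) = iAb_pushout_map K A N h (iAb_compare K A M x)"
  using assms
  by (auto elim!: M.iAb_eq_j simp only: iAb_map_j M.iAb_compare_j N.iAb_compare_j
      iAb_pushout_map_\<kappa> h.hom_closed)

end

section \<open>The involutive center as the space of invariant central elements\<close>

context involutive_bimodule
begin

abbreviation "C \<equiv> centre A M \<inter> invariants M"

lemma submodule_centre: "submodule (centre A M) K M"
proof (rule submoduleI)
  fix m assume m: "m \<in> centre A M"
  \<comment> \<open>The axioms for the actions do not mention negatives or zero; these pass through
    as scalar multiplication by -1 here and by 0 below.\<close>
  have "lact M a (\<ominus>\<^bsub>M\<^esub> m) = \<ominus>\<^bsub>M\<^esub> lact M a m" "ract M (\<ominus>\<^bsub>M\<^esub> m) a = \<ominus>\<^bsub>M\<^esub> ract M m a"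
    if "a \<in> carrier A" for a
    using that m lact_smult[of "\<ominus>\<^bsub>K\<^esub> \<one>\<^bsub>K\<^esub>" a m] smult_ract[of "\<ominus>\<^bsub>K\<^esub> \<one>\<^bsub>K\<^esub>" a m]
    by (simp_all add: centre_def smult_l_minus lact_closed ract_closed)
  then show "\<ominus>\<^bsub>M\<^esub> m \<in> centre A M" using m by (auto simp: centre_def)
next
  have "lact M a \<zero>\<^bsub>M\<^esub> = \<zero>\<^bsub>M\<^esub>" "ract M \<zero>\<^bsub>M\<^esub> a = \<zero>\<^bsub>M\<^esub>" if "a \<in> carrier A" for a
    using that lact_smult[of "\<zero>\<^bsub>K\<^esub>" a "\<zero>\<^bsub>M\<^esub>"] smult_ract[of "\<zero>\<^bsub>K\<^esub>" a "\<zero>\<^bsub>M\<^esub>"]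
    by (simp_all add: lact_closed ract_closed)
  then show "\<zero>\<^bsub>M\<^esub> \<in> centre A M" by (auto simp: centre_def)
qed (auto simp: centre_def lact_add add_ract lact_smult smult_ract)

lemma submodule_invariants: "submodule (invariants M) K M"
proof -
  interpret s: ivs_linear K M M "star M" by (rule ivs_linear_star)
  show ?thesis by (rule submoduleI) (auto simp: invariants_def star_add star_smult)
qed

lemma submodule_C: "submodule C K M"
  using submoduleE[OF submodule_centre] submoduleE[OF submodule_invariants]
    submodule_centre submodule_invariants
  by (intro submoduleI) (auto dest!: submodule.axioms(1) subgroup.one_closed)

lemma involutive_space_C: "involutive_space K (M\<lparr>carrier := C\<rparr>)"
  by (rule involutive_space_subspace[OF involutive_space_axioms submodule_C])
    (auto simp: invariants_def)

lemma iZ_simps: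
  "carrier (iZ K A M) = ibimod_hom K A (regular A) M \<inter> extensional (carrier A)"
  "zero (iZ K A M) = (\<lambda>a\<in>carrier A. \<zero>\<^bsub>M\<^esub>)"
  "add (iZ K A M) = (\<lambda>f g. \<lambda>a\<in>carrier A. f a \<oplus>\<^bsub>M\<^esub> g a)"
  "smult (iZ K A M) = (\<lambda>c f. \<lambda>a\<in>carrier A. c \<odot>\<^bsub>M\<^esub> f a)"
  "star (iZ K A M) = (\<lambda>f. \<lambda>a\<in>carrier A. star M (f (star A a)))"
  by (simp_all add: iZ_def ibimod_Hom_def)

text \<open>f(a) = f(a 1) = a f(1), and extensionality of the elements of \<open>iZ\<close> turns
  this into an equality of functions.\<close>

lemma iZ_eq_lact:
  assumes f: "f \<in> carrier (iZ K A M)"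
  shows "f = (\<lambda>a\<in>carrier A. lact M a (f \<one>\<^bsub>A\<^esub>))"
proof (rule extensionalityI[of _ "carrier A"])
  fix a assume "a \<in> carrier A"
  then show "f a = (\<lambda>a\<in>carrier A. lact M a (f \<one>\<^bsub>A\<^esub>)) a"
    using f ibimod_homD(2)[of f K A "regular A" M a "\<one>\<^bsub>A\<^esub>"] by (simp add: iZ_simps)
qed (use f in \<open>auto simp: iZ_simps\<close>)

text \<open>Centrality comes from evaluating f(a 1) = f(1 a) by the left and the right action;
  invariance comes from star(1) = 1.\<close>

lemma iZ_one_closed:
  assumes f: "f \<in> carrier (iZ K A M)"
  shows "f \<one>\<^bsub>A\<^esub> \<in> C"
proof -
  from f have h: "f \<in> ibimod_hom K A (regular A) M" by (simp add: iZ_simps)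
  note h' = ivs_homD[OF ibimod_homD(1)[OF h]]
  have "lact M a (f \<one>\<^bsub>A\<^esub>) = ract M (f \<one>\<^bsub>A\<^esub>) a" if "a \<in> carrier A" for a
    using that ibimod_homD(2)[OF h, of a "\<one>\<^bsub>A\<^esub>"] ibimod_homD(3)[OF h, of a "\<one>\<^bsub>A\<^esub>"] by simp
  moreover have "star M (f \<one>\<^bsub>A\<^esub>) = f \<one>\<^bsub>A\<^esub>"
    using h'(4)[of "\<one>\<^bsub>A\<^esub>"] by (simp add: A.star_one)
  ultimately show ?thesis
    using h'(1)[of "\<one>\<^bsub>A\<^esub>"] by (auto simp: centre_def invariants_def)
qed

lemma lact_iZ:
  assumes "m \<in> C"
  shows "(\<lambda>a\<in>carrier A. lact M a m) \<in> carrier (iZ K A M)"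
proof -
  have m: "m \<in> carrier M" "star M m = m" "\<And>a. a \<in> carrier A \<Longrightarrow> ract M m a = lact M a m"
    using assms by (auto simp: centre_def invariants_def)
  \<comment> \<open>star(a m) = star(m) star(a) = m star(a) = star(a) m, by invariance and then
    centrality.\<close>
  have "star M (lact M a m) = lact M (star A a) m" if "a \<in> carrier A" for a
    using that m by (simp add: star_lact A.star_closed)
  moreover have "lact M (a \<otimes>\<^bsub>A\<^esub> b) m = ract M (lact M a m) b"
    if "a \<in> carrier A" "b \<in> carrier A" for a b
    using that m by (simp add: lact_mult lact_ract)
  ultimately show ?thesis
    using m by (auto simp: iZ_simps ibimod_hom_def ivs_hom_def lact_closed add_lact smult_lact
      lact_mult A.star_closed)
qed

lemma iZ_image: "(\<lambda>m. \<lambda>a\<in>carrier A. lact M a m) ` C = carrier (iZ K A M)"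
  using lact_iZ iZ_eq_lact iZ_one_closed by blast

text \<open>The structure is transported from the subspace \<open>C\<close> along the inverse of
  evaluation at 1, instead of being checked on functions.\<close>

lemma involutive_space_iZ: "involutive_space K (iZ K A M)"
proof (rule involutive_space_image[OF involutive_space_C])
  show "(\<lambda>m. \<lambda>a\<in>carrier A. lact M a m) ` carrier (M\<lparr>carrier := C\<rparr>) = carrier (iZ K A M)"
    by (simp add: iZ_image)
  have "lact M a \<zero>\<^bsub>M\<^esub> = \<zero>\<^bsub>M\<^esub>" if "a \<in> carrier A" for a
    using that lact_smult[of "\<zero>\<^bsub>K\<^esub>" a "\<zero>\<^bsub>M\<^esub>"] by (simp add: lact_closed)
  then show "(\<lambda>a\<in>carrier A. lact M a \<zero>\<^bsub>M\<lparr>carrier := C\<rparr>\<^esub>) = \<zero>\<^bsub>iZ K A M\<^esub>"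
    by (auto simp: iZ_simps intro!: restrict_ext)
  fix c m assume m: "m \<in> carrier (M\<lparr>carrier := C\<rparr>)"
  \<comment> \<open>star(star(a) m) = star(m) a = m a = a m: the involution of \<open>iZ\<close> is
    the identity, in agreement with \<open>star M\<close> on \<open>C\<close>.\<close>
  then have "lact M a m = star M (lact M (star A a) m)" if "a \<in> carrier A" for a
    using that by (auto simp: star_lact star_ract A.star_closed A.star_star centre_def invariants_def)
  then show "(\<lambda>a\<in>carrier A. lact M a (star (M\<lparr>carrier := C\<rparr>) m)) =
      star (iZ K A M) (\<lambda>a\<in>carrier A. lact M a m)"
    using m by (auto simp: iZ_simps A.star_closed invariants_def intro!: restrict_ext)
qed (auto simp: iZ_simps centre_def lact_add lact_smult intro!: restrict_ext)

lemma iZ_eval_hom: "(\<lambda>f. f \<one>\<^bsub>A\<^esub>) \<in> ivs_hom K (iZ K A M) (M\<lparr>carrier := C\<rparr>)"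
  using iZ_one_closed by (intro ivs_homI) (auto simp: iZ_simps A.star_one)

lemma ivs_iso_iZ_eval: "ivs_iso K (iZ K A M) (M\<lparr>carrier := C\<rparr>) (\<lambda>f. f \<one>\<^bsub>A\<^esub>)"
proof -
  have "bij_betw (\<lambda>f. f \<one>\<^bsub>A\<^esub>) (carrier (iZ K A M)) C"
  proof (rule bij_betw_byWitness[where f' = "\<lambda>m. \<lambda>a\<in>carrier A. lact M a m"])
    show "\<forall>m\<in>C. (\<lambda>a\<in>carrier A. lact M a m) \<one>\<^bsub>A\<^esub> = m"
      by (auto simp: centre_def ract_one)
  qed (use iZ_eq_lact iZ_one_closed lact_iZ in auto)
  then show ?thesis
    using involutive_space_iZ involutive_space_C iZ_eval_hom by (simp add: ivs_iso_def)
qed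

lemma iZ_pullback_simps:
  "carrier (iZ_pullback A M) = (\<lambda>m. (m, m)) ` C"
  "\<zero>\<^bsub>iZ_pullback A M\<^esub> = (\<zero>\<^bsub>M\<^esub>, \<zero>\<^bsub>M\<^esub>)"
  "(v, w) \<oplus>\<^bsub>iZ_pullback A M\<^esub> (v', w') = (v \<oplus>\<^bsub>M\<^esub> v', w \<oplus>\<^bsub>M\<^esub> w')"
  "c \<odot>\<^bsub>iZ_pullback A M\<^esub> (v, w) = (c \<odot>\<^bsub>M\<^esub> v, c \<odot>\<^bsub>M\<^esub> w)"
  "star (iZ_pullback A M) (v, w) = (star M v, star M w)"
  by (auto simp: iZ_pullback_def pullback_def dsum_def Zc_def Inv_def)

lemma diagonal_hom: "(\<lambda>m. (m, m)) \<in> ivs_hom K (M\<lparr>carrier := C\<rparr>) (iZ_pullback A M)"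
  by (intro ivs_homI) (auto simp: iZ_pullback_simps)

lemma involutive_space_iZ_pullback: "involutive_space K (iZ_pullback A M)"
  by (rule involutive_space_image[OF involutive_space_C, where h = "\<lambda>m. (m, m)"])
    (auto simp: iZ_pullback_simps)

lemma ivs_iso_iZ_compare: "ivs_iso K (iZ K A M) (iZ_pullback A M) (iZ_compare A)"
proof -
  have comp: "iZ_compare A = (\<lambda>m. (m, m)) \<circ> (\<lambda>f. f \<one>\<^bsub>A\<^esub>)"
    by (simp add: iZ_compare_def fun_eq_iff)
  have "bij_betw (\<lambda>m. (m, m)) C (carrier (iZ_pullback A M))"
    by (auto simp: bij_betw_def inj_on_def iZ_pullback_simps)
  moreover have "bij_betw (\<lambda>f. f \<one>\<^bsub>A\<^esub>) (carrier (iZ K A M)) C"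
    using ivs_iso_iZ_eval by (simp add: ivs_iso_def)
  ultimately have "bij_betw (iZ_compare A) (carrier (iZ K A M)) (carrier (iZ_pullback A M))"
    unfolding comp by (rule bij_betw_trans[rotated])
  moreover have "iZ_compare A \<in> ivs_hom K (iZ K A M) (iZ_pullback A M)"
    unfolding iZ_compare_def[abs_def] by (rule ivs_hom_comp[OF iZ_eval_hom diagonal_hom])
  ultimately show ?thesis
    using involutive_space_iZ involutive_space_iZ_pullback by (simp add: ivs_iso_def)
qed

text \<open>The pointwise star of a homomorphism need not be a bimodule homomorphism, so the two
  involutions are matched through evaluation at 1 and not inside \<open>iZ\<close>.\<close>

lemma iZ_compare_pointwise_star:
  "iZ_compare A (pointwise_star A M f) = star (iZ_pullback A M) (iZ_compare A f)"
  by (simp add: iZ_compare_def pointwise_star_def iZ_pullback_simps)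

end

section \<open>Naturality of the comparison for the center\<close>

context ibimod_map
begin

lemma h_C: "m \<in> M.C \<Longrightarrow> h m \<in> N.C"
  by (auto simp: centre_def invariants_def simp flip: h_lact h_ract h.hom_star)

lemma iZ_map_hom: "iZ_map A h \<in> ivs_hom K (iZ K A M) (iZ K A N)"
proof (rule ivs_homI)
  fix f assume f: "f \<in> carrier (iZ K A M)"
  then have f': "f \<in> ibimod_hom K A (regular A) M" by (simp add: M.iZ_simps)
  note F = ivs_homD[OF ibimod_homD(1)[OF f'], simplified]
  \<comment> \<open>Once the composite is written as a acting on h(f(1)), an invariant central
    element of N, \<open>lact_iZ\<close> yields all conditions for membership in \<open>iZ\<close>
    at once.\<close>
  have "iZ_map A h f = (\<lambda>a\<in>carrier A. lact N a (h (f \<one>\<^bsub>A\<^esub>)))"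
    unfolding iZ_map_def
    by (rule restrict_ext, subst M.iZ_eq_lact[OF f]) (use F in \<open>simp add: h_lact\<close>)
  then show "iZ_map A h f \<in> carrier (iZ K A N)"
    using N.lact_iZ[OF h_C[OF M.iZ_one_closed[OF f]]] by simp
  show "iZ_map A h (star (iZ K A M) f) = star (iZ K A N) (iZ_map A h f)"
    using F by (auto simp: iZ_map_def M.iZ_simps N.iZ_simps h.hom_star M.A.star_closed M.star_closed intro!: restrict_ext)
  show "iZ_map A h (c \<odot>\<^bsub>iZ K A M\<^esub> f) = c \<odot>\<^bsub>iZ K A N\<^esub> iZ_map A h f" if "c \<in> carrier K" for c
    using F that by (auto simp: iZ_map_def M.iZ_simps N.iZ_simps h.hom_smult intro!: restrict_ext)
  fix g assume g: "g \<in> carrier (iZ K A M)"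
  then have g': "g \<in> ibimod_hom K A (regular A) M" by (simp add: M.iZ_simps)
  note G = ivs_homD[OF ibimod_homD(1)[OF g'], simplified]
  show "iZ_map A h (f \<oplus>\<^bsub>iZ K A M\<^esub> g) = iZ_map A h f \<oplus>\<^bsub>iZ K A N\<^esub> iZ_map A h g"
    using F G by (auto simp: iZ_map_def M.iZ_simps N.iZ_simps h.hom_add intro!: restrict_ext)
qed

lemma iZ_pullback_map_hom: "map_prod h h \<in> ivs_hom K (iZ_pullback A M) (iZ_pullback A N)"
proof -
  have C: "m \<in> carrier M" "h m \<in> centre A N" "h m \<in> invariants N"
    if "m \<in> centre A M" "m \<in> invariants M" for m
    using that h_C[of m] by (auto simp: invariants_def)
  show ?thesis
    by (intro ivs_homI)
      (auto simp: M.iZ_pullback_simps N.iZ_pullback_simps h.hom_add h.hom_smult h.hom_star C)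
qed

lemma iZ_compare_natural: "iZ_compare A (iZ_map A h f) = map_prod h h (iZ_compare A f)"
  by (simp add: iZ_compare_def iZ_map_def)

end

theorem proposition2p4p1:
  fixes K :: "'k ring" and A :: "('k, 'a) ivs" and M :: "('k, 'a, 'm) ibimod"
  assumes "field K" and "involutive_algebra K A" and "involutive_bimodule K A M"
  shows
    "(ivs_iso K (iZ K A M) (iZ_pullback A M) (iZ_compare A) \<and>
      ivs_iso K (iZ K A M) (M\<lparr>carrier := centre A M \<inter> invariants M\<rparr>) (\<lambda>f. f \<one>\<^bsub>A\<^esub>) \<and>
      (\<forall>f\<in>carrier (iZ K A M).
         iZ_compare A (pointwise_star A M f) = star (iZ_pullback A M) (iZ_compare A f)) \<and>
      (\<forall>(N :: ('k, 'a, 'n) ibimod) h.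
         involutive_bimodule K A N \<and> h \<in> ibimod_hom K A M N \<longrightarrow>
           iZ_map A h \<in> ivs_hom K (iZ K A M) (iZ K A N) \<and>
           map_prod h h \<in> ivs_hom K (iZ_pullback A M) (iZ_pullback A N) \<and>
           (\<forall>f\<in>carrier (iZ K A M).
              iZ_compare A (iZ_map A h f) = map_prod h h (iZ_compare A f))))
     \<and>
     (ivs_iso K (iAb K A M) (iAb_pushout K A M) (iAb_compare K A M) \<and>
      (\<forall>\<sigma>. involutive_space K ((iAb K A M)\<lparr>star := \<sigma>\<rparr>) \<and>
         (\<forall>a\<in>carrier A. \<forall>m\<in>carrier M.
            \<sigma> (pure_ienv K A (regular A) M a m) = pure_ienv K A (regular A) M (star A a) m) \<longrightarrow>
         ivs_iso K ((iAb K A M)\<lparr>star := \<sigma>\<rparr>) (iAb_pushout K A M) (iAb_compare K A M)) \<and>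
      (\<forall>(N :: ('k, 'a, 'n) ibimod) h.
         involutive_bimodule K A N \<and> h \<in> ibimod_hom K A M N \<longrightarrow>
           iAb_map K A M N h \<in> ivs_hom K (iAb K A M) (iAb K A N) \<and>
           iAb_pushout_map K A N h \<in> ivs_hom K (iAb_pushout K A M) (iAb_pushout K A N) \<and>
           (\<forall>x\<in>carrier (iAb K A M).
              iAb_compare K A N (iAb_map K A M N h x) =
              iAb_pushout_map K A N h (iAb_compare K A M x))))"
proof -
  interpret M: ibimod_quotients K A M
    by (rule ibimod_quotients.intro[OF assms(3)])
  have map: "ibimod_map K A M N h"
    if "involutive_bimodule K A N" "h \<in> ibimod_hom K A M N" for N :: "('k, 'a, 'n) ibimod" and h
    using that assms(3) by (simp add: ibimod_map_def ibimod_map_axioms_def ibimod_quotients_def)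
  show ?thesis
    using M.ivs_iso_iZ_compare M.ivs_iso_iZ_eval M.iZ_compare_pointwise_star
      M.ivs_iso_iAb_compare M.ivs_iso_iAb_compare_star
      ibimod_map.iZ_map_hom[OF map] ibimod_map.iZ_pullback_map_hom[OF map]
      ibimod_map.iZ_compare_natural[OF map] ibimod_map.iAb_map_hom[OF map]
      ibimod_map.iAb_pushout_map_hom[OF map] ibimod_map.iAb_compare_natural[OF map]
    by (intro conjI ballI allI impI; (elim conjE)?; simp)
qed

end
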